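(* Let $R'/R$ be a flat numerical semigroup algebra over a field $\kappa$. If the Apéry monomials of $R'/R$ form a non-singular rectangle, then $R'/R$ is a complete intersection.
   Context: Let $\kappa$ be a field. A numerical semigroup is a monoid $S$ (under addition) generated by finitely many (at least one) positive rational numbers; it is not required to consist of integers. The numerical semigroup ring $\kappa[\![\mathbf{u}^S]\!]$ consists of all power series $\sum_{s\in S}a_s\mathbf{u}^s$ with $a_s\in\kappa$; the elements $\mathbf{u}^s$ ($s\in S$) are its monomials. For numerical semigroups $S\subset S'$, put $R=\kappa[\![\mathbf{u}^S]\!]$ and $R'=\kappa[\![\mathbf{u}^{S'}]\!]$; then $R'$ is an $R$-algebra via inclusion, denoted $R'/R$ and called a numerical semigroup algebra. (Any embedding $tS\subset S'$ with $t$ a positive rational is reduced to this case by scaling.) The algebra is flat if $R'$ is a flat $R$-module. A monomial $p$ of $R'$ is an Apéry monomial of $R'/R$ if, whenever $p=p_1p_2$ with $p_1$ a monomial of $R$ and $p_2$ a monomial of $R'$, then $p_1=1$. An Apéry monomial $p\neq 1$ is a minimal monomial if, whenever $p=p_1p_2$ with $p_1,p_2$ monomials of $R'$, one of $p_1,p_2$ equals $p$. Let $\mathbf{u}^{s_1},\ldots,\mathbf{u}^{s_n}$ be the (distinct) minimal monomials of $R'/R$. The set of Apéry monomials is called a rectangle of size $\beta_1\times\cdots\times\beta_n$ (for positive integers $\beta_i$) if every Apéry monomial can be written uniquely as $(\mathbf{u}^{s_1})^{\ell_1}\cdots(\mathbf{u}^{s_n})^{\ell_n}$ with integers $0\le\ell_i<\beta_i$,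 and every monomial $(\mathbf{u}^{s_1})^{\ell_1}\cdots(\mathbf{u}^{s_n})^{\ell_n}$ with $0\le\ell_i<\beta_i$ is Apéry. If $R'/R$ is flat and its Apéry monomials form a rectangle of size $\beta_1\times\cdots\times\beta_n$, then for each $i$ there is a unique factorization $\mathbf{u}^{s_i\beta_i}=\mathbf{u}^{t_i}(\mathbf{u}^{s_1})^{\beta_{i1}}\cdots(\mathbf{u}^{s_n})^{\beta_{in}}$ with $\mathbf{u}^{t_i}\in R$ and integers $0\le\beta_{ij}<\beta_j$ for all $j$; here $\beta_{ii}=0$. The rectangle (of the given size) is called non-singular if the $n\times n$ matrix with diagonal entries $\beta_1,\ldots,\beta_n$ and $(i,j)$ entry $-\beta_{ij}$ for $i\ne j$ is invertible over $\mathbb{Q}$. A flat numerical semigroup algebra $R'/R$ is a complete intersection if there is a surjective local $R$-algebra homomorphism $R[\![Y_1,\ldots,Y_m]\!]\to R'$ (for some $m$) whose kernel can be generated by $m$ elements. *)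

theory Defs
  imports
    "HOL-Algebra.Algebra"
    "HOL-Algebra.Free_Abelian_Groups"
    "HOL-Algebra.Indexed_Polynomials"
    "Jordan_Normal_Form.Matrix"
begin

section \<open>Numerical semigroup rings\<close>

definition add_submonoid :: "'a::monoid_add set \<Rightarrow> bool" where
  "add_submonoid M \<longleftrightarrow> 0 \<in> M \<and> (\<forall>x\<in>M. \<forall>y\<in>M. x + y \<in> M)"

definition numerical_semigroup :: "rat set \<Rightarrow> bool" where
  "numerical_semigroup S \<longleftrightarrow>
     (\<exists>G. finite G \<and> G \<noteq> {} \<and> (\<forall>g\<in>G. 0 < g) \<and> S = add_submonoid hull G)"

text \<open>
  The power series with coefficients \<open>a\<^sub>s\<close> is the function \<open>s \<mapsto> a\<^sub>s\<close> on the rationals, vanishing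
  outside \<open>S\<close>. The index set in the product is finite when \<open>f\<close> and \<open>g\<close> are supported in a numerical
  semigroup. The operations do not depend on \<open>S\<close>, so for \<open>S \<subseteq> S'\<close> the ring of \<open>S\<close> is literally a
  subring of the ring of \<open>S'\<close>.
\<close>

definition ns_ring :: "rat set \<Rightarrow> (rat \<Rightarrow> 'k::field) ring" where
  "ns_ring S =
     \<lparr>carrier = {f. \<forall>s. f s \<noteq> 0 \<longrightarrow> s \<in> S},
      monoid.mult = (\<lambda>f g s. \<Sum>a | f a \<noteq> 0 \<and> g (s - a) \<noteq> 0. f a * g (s - a)),
      monoid.one = (\<lambda>s. if s = 0 then 1 else 0),
      ring.zero = (\<lambda>s. 0),
      ring.add = (\<lambda>f g s. f s + g s)\<rparr>"

definition u_pow :: "rat \<Rightarrow> rat \<Rightarrow> 'k::field" where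
  "u_pow s = (\<lambda>x. if x = s then 1 else 0)"

section \<open>Apery monomials and rectangles\<close>

definition apery_monomials :: "rat set \<Rightarrow> rat set \<Rightarrow> (rat \<Rightarrow> 'k::field) set" where
  "apery_monomials S S' =
     {p \<in> u_pow ` S'. \<forall>p1 \<in> u_pow ` S. \<forall>p2 \<in> u_pow ` S'.
        p = p1 \<otimes>\<^bsub>ns_ring S'\<^esub> p2 \<longrightarrow> p1 = \<one>\<^bsub>ns_ring S'\<^esub>}"

definition minimal_monomials :: "rat set \<Rightarrow> rat set \<Rightarrow> (rat \<Rightarrow> 'k::field) set" where
  "minimal_monomials S S' =
     {p \<in> apery_monomials S S'. p \<noteq> \<one>\<^bsub>ns_ring S'\<^esub> \<and>
        (\<forall>p1 \<in> u_pow ` S'. \<forall>p2 \<in> u_pow ` S'.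
           p = p1 \<otimes>\<^bsub>ns_ring S'\<^esub> p2 \<longrightarrow> p1 = p \<or> p2 = p)}"

definition power_product :: "rat set \<Rightarrow> nat \<Rightarrow> (nat \<Rightarrow> rat) \<Rightarrow> (nat \<Rightarrow> nat) \<Rightarrow> rat \<Rightarrow> 'k::field" where
  "power_product S' n s l =
     (\<Otimes>\<^bsub>ns_ring S'\<^esub>i\<in>{..<n}. u_pow (s i) [^]\<^bsub>ns_ring S'\<^esub> l i)"

text \<open>
  The minimal monomials are \<open>u_pow (s 0), \<dots>, u_pow (s (n - 1))\<close>, without repetition, and the
  sizes are \<open>\<beta> 0, \<dots>, \<beta> (n - 1)\<close>. The type argument is the coefficient field.
\<close>

definition apery_rectangle ::
  "'k::field itself \<Rightarrow> rat set \<Rightarrow> rat set \<Rightarrow> nat \<Rightarrow> (nat \<Rightarrow> rat) \<Rightarrow> (nat \<Rightarrow> nat) \<Rightarrow> bool" where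
  "apery_rectangle _ S S' n s \<beta> \<longleftrightarrow>
     bij_betw (\<lambda>i. u_pow (s i)) {..<n} (minimal_monomials S S' :: (rat \<Rightarrow> 'k) set) \<and>
     (\<forall>i<n. 0 < \<beta> i) \<and>
     (\<forall>p \<in> (apery_monomials S S' :: (rat \<Rightarrow> 'k) set).
        \<exists>!l. l \<in> (\<Pi>\<^sub>E i\<in>{..<n}. {..<\<beta> i}) \<and> p = power_product S' n s l) \<and>
     (\<forall>l \<in> (\<Pi>\<^sub>E i\<in>{..<n}. {..<\<beta> i}).
        power_product S' n s l \<in> (apery_monomials S S' :: (rat \<Rightarrow> 'k) set))"

text \<open>
  For a flat algebra whose Apery monomials form a rectangle, the exponents \<open>t i\<close> and \<open>B i j\<close>
  (\<open>i, j < n\<close>) exist and are unique, so the existential quantifier only names them.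
\<close>

definition nonsingular_apery_rectangle ::
  "'k::field itself \<Rightarrow> rat set \<Rightarrow> rat set \<Rightarrow> nat \<Rightarrow> (nat \<Rightarrow> rat) \<Rightarrow> (nat \<Rightarrow> nat) \<Rightarrow> bool" where
  "nonsingular_apery_rectangle k S S' n s \<beta> \<longleftrightarrow>
     apery_rectangle k S S' n s \<beta> \<and>
     (\<exists>(t :: nat \<Rightarrow> rat) (B :: nat \<Rightarrow> nat \<Rightarrow> nat).
        (\<forall>i<n. t i \<in> S \<and> (\<forall>j<n. B i j < \<beta> j) \<and>
           (u_pow (s i * of_nat (\<beta> i)) :: rat \<Rightarrow> 'k)
             = u_pow (t i) \<otimes>\<^bsub>ns_ring S'\<^esub> power_product S' n s (B i)) \<and>
        invertible_mat
          (mat n n (\<lambda>(i, j). if i = j then of_nat (\<beta> i) else - of_nat (B i j)) :: rat mat))"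

section \<open>Flat modules\<close>

definition module_hom ::
  "('r, 'a) ring_scheme \<Rightarrow> ('r, 'm, 'b) module_scheme \<Rightarrow> ('r, 'n, 'c) module_scheme \<Rightarrow> ('m \<Rightarrow> 'n) set"
  where
  "module_hom R M N =
     {f \<in> carrier M \<rightarrow> carrier N.
        (\<forall>x\<in>carrier M. \<forall>y\<in>carrier M. f (x \<oplus>\<^bsub>M\<^esub> y) = f x \<oplus>\<^bsub>N\<^esub> f y) \<and>
        (\<forall>r\<in>carrier R. \<forall>x\<in>carrier M. f (r \<odot>\<^bsub>M\<^esub> x) = r \<odot>\<^bsub>N\<^esub> f x)}"

text \<open>
  The tensor product over \<open>R\<close>, as an abelian group (written multiplicatively): the free abelian
  group on pairs modulo the subgroup generated by the bilinearity relations.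
\<close>

abbreviation tensor_free ::
  "('r, 'm, 'b) module_scheme \<Rightarrow> ('r, 'n, 'c) module_scheme \<Rightarrow> ('m \<times> 'n \<Rightarrow>\<^sub>0 int) monoid" where
  "tensor_free M P \<equiv> free_Abelian_group (carrier M \<times> carrier P)"

definition tensor_relations ::
  "('r, 'a) ring_scheme \<Rightarrow> ('r, 'm, 'b) module_scheme \<Rightarrow> ('r, 'n, 'c) module_scheme
     \<Rightarrow> ('m \<times> 'n \<Rightarrow>\<^sub>0 int) set" where
  "tensor_relations R M P = generate (tensor_free M P)
     ({frag_of (x \<oplus>\<^bsub>M\<^esub> x', y) - frag_of (x, y) - frag_of (x', y) | x x' y.
         x \<in> carrier M \<and> x' \<in> carrier M \<and> y \<in> carrier P} \<union>
      {frag_of (x, y \<oplus>\<^bsub>P\<^esub> y') - frag_of (x, y) - frag_of (x, y') | x y y'.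
         x \<in> carrier M \<and> y \<in> carrier P \<and> y' \<in> carrier P} \<union>
      {frag_of (r \<odot>\<^bsub>M\<^esub> x, y) - frag_of (x, r \<odot>\<^bsub>P\<^esub> y) | r x y.
         r \<in> carrier R \<and> x \<in> carrier M \<and> y \<in> carrier P})"

definition tensor_product ::
  "('r, 'a) ring_scheme \<Rightarrow> ('r, 'm, 'b) module_scheme \<Rightarrow> ('r, 'n, 'c) module_scheme
     \<Rightarrow> ('m \<times> 'n \<Rightarrow>\<^sub>0 int) set monoid" where
  "tensor_product R M P = tensor_free M P Mod tensor_relations R M P"

text \<open>The map \<open>f \<otimes> id\<close> from \<open>M \<otimes> P\<close> to \<open>N \<otimes> P\<close> induced by \<open>f\<close>, on cosets.\<close>

definition tensor_map ::
  "('r, 'a) ring_scheme \<Rightarrow> ('r, 'n, 'b) module_scheme \<Rightarrow> ('r, 'p, 'c) module_scheme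
     \<Rightarrow> ('m \<Rightarrow> 'n) \<Rightarrow> ('m \<times> 'p \<Rightarrow>\<^sub>0 int) set \<Rightarrow> ('n \<times> 'p \<Rightarrow>\<^sub>0 int) set" where
  "tensor_map R N P f C =
     tensor_relations R N P <#>\<^bsub>tensor_free N P\<^esub> frag_extend (\<lambda>(x, y). frag_of (f x, y)) ` C"

text \<open>
  Tensoring with \<open>P\<close> preserves injectivity. A definition cannot quantify over types, so the test
  modules have carriers in the element type of \<open>R\<close>. This loses nothing: every inclusion of an
  ideal into \<open>R\<close> is among the tests, and preservation of these already implies preservation
  of all injections, in any type.
\<close>

definition flat_module :: "('r, 'a) ring_scheme \<Rightarrow> ('r, 'p, 'b) module_scheme \<Rightarrow> bool" where
  "flat_module R P \<longleftrightarrow> module R P \<and>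
     (\<forall>(M :: ('r, 'r) module) (N :: ('r, 'r) module) f.
        module R M \<and> module R N \<and> f \<in> module_hom R M N \<and> inj_on f (carrier M) \<longrightarrow>
        inj_on (tensor_map R N P f) (carrier (tensor_product R M P)))"

text \<open>A ring as a module over any of its subrings.\<close>

definition ring_as_module :: "'r ring \<Rightarrow> ('r, 'r) module" where
  "ring_as_module R' =
     \<lparr>carrier = carrier R', monoid.mult = monoid.mult R', monoid.one = monoid.one R', ring.zero = ring.zero R', ring.add = ring.add R',
      smult = monoid.mult R'\<rparr>"

section \<open>Complete intersections\<close>

definition local_ring :: "('a, 'b) ring_scheme \<Rightarrow> bool" where
  "local_ring A \<longleftrightarrow> cring A \<and> (\<exists>!I. maximalideal I A)"

definition local_ring_hom :: "('a, 'c) ring_scheme \<Rightarrow> ('b, 'd) ring_scheme \<Rightarrow> ('a \<Rightarrow> 'b) set" where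
  "local_ring_hom A B =
     {\<phi> \<in> Ring.ring_hom A B. local_ring A \<and> local_ring B \<and>
        (\<forall>I J. maximalideal I A \<and> maximalideal J B \<longrightarrow> \<phi> ` I \<subseteq> J)}"

text \<open>
  The power series ring in variables indexed by \<open>{..<m}\<close>. As for indexed polynomials, a multiset
  of variables encodes a monomial, so that \<open>B \<subseteq># A\<close> is divisibility.
\<close>

definition power_series_ring :: "('r, 'a) ring_scheme \<Rightarrow> nat \<Rightarrow> (nat multiset \<Rightarrow> 'r) ring" where
  "power_series_ring R m =
     \<lparr>carrier = {f. (\<forall>A. f A \<in> carrier R) \<and> (\<forall>A. \<not> set_mset A \<subseteq> {..<m} \<longrightarrow> f A = \<zero>\<^bsub>R\<^esub>)},
      monoid.mult = (\<lambda>f g A. \<Oplus>\<^bsub>R\<^esub>B\<in>{B. B \<subseteq># A}. f B \<otimes>\<^bsub>R\<^esub> g (A - B)),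
      monoid.one = ring.indexed_const R \<one>\<^bsub>R\<^esub>,
      ring.zero = ring.indexed_const R \<zero>\<^bsub>R\<^esub>,
      ring.add = ring.indexed_padd R\<rparr>"

text \<open>Here \<open>R\<close> is a subring of \<open>R'\<close>, and \<open>R'\<close> is an \<open>R\<close>-algebra by inclusion.\<close>

definition complete_intersection :: "'r ring \<Rightarrow> 'r ring \<Rightarrow> bool" where
  "complete_intersection R R' \<longleftrightarrow>
     (\<exists>m \<phi>. \<phi> \<in> local_ring_hom (power_series_ring R m) R' \<and>
        (\<forall>r\<in>carrier R. \<phi> (ring.indexed_const R r) = r) \<and>
        \<phi> ` carrier (power_series_ring R m) = carrier R' \<and>
        (\<exists>F. F \<in> {..<m} \<rightarrow> carrier (power_series_ring R m) \<and>
           a_kernel (power_series_ring R m) R' \<phi> = Idl\<^bsub>power_series_ring R m\<^esub> (F ` {..<m})))"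

end

theory Submission
  imports Defs "HOL-Library.Product_Plus"
begin

text \<open>
  Flatness makes the decomposition \<open>d = a + w\<close> of an exponent \<open>d \<in> S'\<close> into \<open>a \<in> S\<close> and an Apery
  exponent \<open>w\<close> unique, so with a rectangle every degree contains exactly one monomial \<open>u\<^sup>a Y\<^sup>l\<close> with
  \<open>l i < \<beta> i\<close> for all \<open>i\<close>. Map \<open>Y i\<close> to \<open>u\<close> to the power \<open>s i\<close>; the kernel contains the \<open>n\<close> binomials
  that replace \<open>\<beta> i\<close> copies of \<open>Y i\<close> by \<open>u\<close> to the power \<open>t i\<close> times the product of the \<open>B i j\<close>-th
  powers of the \<open>Y j\<close>. Non-singularity of the matrix \<open>M\<close> gives a rational vector \<open>v\<close> with \<open>M v = (1, \<dots>, 1)\<close>,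
  that is, a linear potential on exponents that drops by one at each replacement. Since only finitely
  many monomials have a given degree, rewriting terminates, and each monomial is congruent modulo the
  binomials to the unique reduced monomial of its degree. Hence the binomials generate the kernel,
  degree by degree.
\<close>

section \<open>Convolution of functions on a weighted monoid\<close>

text \<open>The rings involved are encoded differently: \<open>R\<close> and \<open>R'\<close>
  consist of functions on the rationals, the power series ring of functions from multisets to such
  functions. All three are rings of functions on a monoid with an additive weight in the natural
  numbers that has finite fibres and vanishes only at 0. Finiteness makes convolution a finite sum,
  and recursion on the weight inverts every element with non-zero constant term. So one abstract
  argument shows that these rings are local, and the homomorphism is local as soon as it preserves
  constant terms.

  Flatness is used for one ideal \<open>I\<close> of \<open>R\<close>: products
  \<open>x p = y q\<close> in \<open>R'\<close> make \<open>x \<otimes> p\<close> and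
  \<open>y \<otimes> q\<close> equal in the tensor product of \<open>R\<close> with
  \<open>R'\<close>, hence already in that of \<open>I\<close> with \<open>R'\<close>. A functional
  on the latter then detects two different decompositions of one exponent.

  The remaining obstacle is completeness: a kernel element may have infinitely many homogeneous
  parts, whereas an element of the ideal is a finite combination of the binomials. The contributions
  of all degrees must therefore merge into one power series coefficient per binomial.\<close>

locale weighted_monoid =
  fixes E :: "'a::comm_monoid_add set" and wt :: "'a \<Rightarrow> nat"
  assumes zero_mem: "0 \<in> E"
    and add_mem: "x \<in> E \<Longrightarrow> y \<in> E \<Longrightarrow> x + y \<in> E"
    and wt_add: "x \<in> E \<Longrightarrow> y \<in> E \<Longrightarrow> wt (x + y) = wt x + wt y"
    and wt_eq_0D: "x \<in> E \<Longrightarrow> wt x = 0 \<Longrightarrow> x = 0"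
    and finite_fibre: "finite {x \<in> E. wt x = d}"
begin

definition splits :: "'a \<Rightarrow> ('a \<times> 'a) set" where
  "splits x = {(a, b). a \<in> E \<and> b \<in> E \<and> a + b = x}"

definition conv :: "('a \<Rightarrow> 'k::field) \<Rightarrow> ('a \<Rightarrow> 'k) \<Rightarrow> 'a \<Rightarrow> 'k" where
  "conv f g x = (\<Sum>(a, b)\<in>splits x. f a * g b)"

lemma wt_0: "wt 0 = 0"
  using wt_add[OF zero_mem zero_mem] by simp

lemma finite_wt_le: "finite {x \<in> E. wt x \<le> d}"
proof -
  have "{x \<in> E. wt x \<le> d} = (\<Union>k\<le>d. {x \<in> E. wt x = k})" by auto
  then show ?thesis using finite_fibre by simp
qed

lemma finite_splits: "finite (splits x)"
proof (rule finite_subset)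
  show "splits x \<subseteq> {y \<in> E. wt y \<le> wt x} \<times> {y \<in> E. wt y \<le> wt x}"
    by (auto simp: splits_def wt_add)
qed (simp add: finite_wt_le)

lemma splits_notin: "x \<notin> E \<Longrightarrow> splits x = {}"
  by (auto simp: splits_def add_mem)

lemma splits_0: "splits 0 = {(0, 0)}"
proof -
  have "a = 0 \<and> b = 0" if "a \<in> E" "b \<in> E" "a + b = 0" for a b
    using wt_add[OF that(1,2)] that wt_0 wt_eq_0D by auto
  then show ?thesis using zero_mem by (auto simp: splits_def)
qed

lemma conv_notin: "x \<notin> E \<Longrightarrow> conv f g x = 0"
  by (simp add: conv_def splits_notin)

lemma conv_at_0: "conv f g 0 = f 0 * g 0"
  by (simp add: conv_def splits_0)

lemma conv_commute: "conv f g = conv g f"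
proof
  fix x
  show "conv f g x = conv g f x"
    unfolding conv_def
    by (rule sum.reindex_bij_witness[where i = prod.swap and j = prod.swap])
      (auto simp: splits_def add.commute mult.commute)
qed

lemma conv_assoc: "conv (conv f g) h = conv f (conv g h)"
proof
  fix x
  have "conv (conv f g) h x
      = (\<Sum>p\<in>splits x. \<Sum>q\<in>splits (fst p). f (fst q) * g (snd q) * h (snd p))"
    by (simp add: conv_def sum_distrib_right case_prod_beta)
  also have "\<dots> = (\<Sum>(p, q)\<in>(SIGMA p:splits x. splits (fst p)). f (fst q) * g (snd q) * h (snd p))"
    by (rule sum.Sigma) (auto simp: finite_splits)
  \<comment> \<open>Both index sets are the triples \<open>(a, b, c)\<close> from \<open>E\<close>
    with \<open>a + b + c = x\<close>, bracketed differently.\<close>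
  also have "\<dots> = (\<Sum>(p, q)\<in>(SIGMA p:splits x. splits (snd p)). f (fst p) * (g (fst q) * h (snd q)))"
    by (rule sum.reindex_bij_witness
        [where j = "\<lambda>((p, c), (a, b)). ((a, b + c), (b, c))"
          and i = "\<lambda>((a, p), (b, c)). ((a + b, c), (a, b))"])
      (auto simp: splits_def add_mem add.assoc mult.assoc)
  also have "\<dots> = (\<Sum>p\<in>splits x. \<Sum>q\<in>splits (snd p). f (fst p) * (g (fst q) * h (snd q)))"
    by (rule sum.Sigma[symmetric]) (auto simp: finite_splits)
  also have "\<dots> = conv f (conv g h) x"
    by (simp add: conv_def sum_distrib_left case_prod_beta)
  finally show "conv (conv f g) h x = conv f (conv g h) x" .
qed

lemma conv_add_left: "conv (\<lambda>x. f x + g x) h x = conv f h x + conv g h x"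
  by (simp add: conv_def case_prod_beta distrib_right sum.distrib)

lemma conv_diff_left: "conv (\<lambda>x. f x - g x) h x = conv f h x - conv g h x"
  by (simp add: conv_def case_prod_beta left_diff_distrib sum_subtractf)

lemma conv_scale_left: "conv (\<lambda>x. c * f x) h x = c * conv f h x"
  by (simp add: conv_def case_prod_beta sum_distrib_left mult.assoc)

lemma conv_zero_left: "conv (\<lambda>_. 0) h x = 0"
  by (simp add: conv_def case_prod_beta)

lemma conv_single_left:
  assumes "a \<in> E"
  shows "conv (\<lambda>x. if x = a then 1 else 0) g x = (\<Sum>b | b \<in> E \<and> a + b = x. g b)"
proof -
  have "conv (\<lambda>x. if x = a then 1 else 0) g x = (\<Sum>p\<in>{p \<in> splits x. fst p = a}. g (snd p))"
    unfolding conv_def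
    by (rule sum.mono_neutral_cong_right) (auto simp: finite_splits split: if_splits)
  also have "\<dots> = (\<Sum>b | b \<in> E \<and> a + b = x. g b)"
    by (rule sum.reindex_bij_witness[where i = "Pair a" and j = snd])
      (use assms in \<open>auto simp: splits_def\<close>)
  finally show ?thesis .
qed

lemma conv_single:
  assumes "a \<in> E" "b \<in> E"
  shows "conv (\<lambda>x. if x = a then 1 else 0) (\<lambda>x. if x = b then 1 else 0)
    = (\<lambda>x. if x = a + b then 1 else (0 :: 'k::field))"
proof
  fix x
  have "conv (\<lambda>x. if x = a then 1 else 0) (\<lambda>x. if x = b then 1 else 0) x
      = (\<Sum>c\<in>{c \<in> E. a + c = x}. if c = b then 1 else (0 :: 'k))"
    by (simp add: conv_single_left[OF assms(1)])
  also have "\<dots> = (if x = a + b then 1 else 0)"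
  proof (cases "x = a + b")
    case True
    have "finite {c \<in> E. a + c = x}"
      by (rule finite_subset[OF _ finite_wt_le[of "wt x"]]) (use assms in \<open>auto simp: wt_add\<close>)
    then show ?thesis using assms True by simp
  qed (auto intro!: sum.neutral)
  finally show "conv (\<lambda>x. if x = a then 1 else 0) (\<lambda>x. if x = b then 1 else 0) x
      = (if x = a + b then 1 else (0 :: 'k))" .
qed

lemma conv_one_left:
  assumes "\<And>x. f x \<noteq> 0 \<Longrightarrow> x \<in> E"
  shows "conv (\<lambda>x. if x = 0 then 1 else 0) f = f"
proof
  fix x
  show "conv (\<lambda>x. if x = 0 then 1 else 0) f x = f x"
  proof (cases "x \<in> E")
    case True
    then have "{b. b \<in> E \<and> b = x} = {x}" by auto
    then show ?thesis by (simp add: conv_single_left[OF zero_mem])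
  next
    case False
    then show ?thesis using assms[of x] by (auto simp: conv_notin)
  qed
qed

text \<open>The equation for the inverse at \<open>x\<close>, solved for its value there: the
  splitting \<open>(0, x)\<close> contributes \<open>f 0\<close> times that value, and all other
  splittings involve arguments of smaller weight because a non-zero first part has positive weight.
  The value 0 outside \<open>E\<close> keeps the result in the image of the ring.\<close>

function conv_inverse :: "('a \<Rightarrow> 'k::field) \<Rightarrow> 'a \<Rightarrow> 'k" where
  "conv_inverse f x =
     (if x \<in> E then
        ((if x = 0 then 1 else 0)
          - (\<Sum>p\<in>{p \<in> splits x. fst p \<noteq> 0}. f (fst p) * conv_inverse f (snd p))) / f 0
      else 0)"
  by auto
termination
proof (relation "measure (\<lambda>(f, x). wt x)")
  fix f :: "'a \<Rightarrow> 'k" and x p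
  assume "p \<in> {p \<in> splits x. fst p \<noteq> 0}"
  then have "fst p \<in> E" "fst p \<noteq> 0" "wt x = wt (fst p) + wt (snd p)"
    by (auto simp: splits_def wt_add)
  moreover from this have "wt (fst p) \<noteq> 0" using wt_eq_0D by blast
  ultimately show "((f, snd p), f, x) \<in> measure (\<lambda>(f, x). wt x)" by simp
qed simp

declare conv_inverse.simps [simp del]

lemma conv_inverse_notin: "x \<notin> E \<Longrightarrow> conv_inverse f x = 0"
  by (simp add: conv_inverse.simps)

lemma conv_conv_inverse:
  assumes "f 0 \<noteq> 0"
  shows "conv f (conv_inverse f) = (\<lambda>x. if x = 0 then 1 else 0)"
proof
  fix x
  show "conv f (conv_inverse f) x = (if x = 0 then 1 else 0)"
  proof (cases "x \<in> E")
    case True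
    let ?T = "{p \<in> splits x. fst p \<noteq> 0}"
    have eq: "splits x = insert (0, x) ?T"
      using True zero_mem by (auto simp: splits_def)
    have "conv f (conv_inverse f) x
        = (\<Sum>p\<in>insert (0, x) ?T. f (fst p) * conv_inverse f (snd p))"
      unfolding conv_def case_prod_beta using eq by argo
    also have "\<dots> = f 0 * conv_inverse f x + (\<Sum>p\<in>?T. f (fst p) * conv_inverse f (snd p))"
      by (subst sum.insert) (auto simp: finite_splits)
    also have "\<dots> = (if x = 0 then 1 else 0)"
      using assms True by (subst conv_inverse.simps) simp
    finally show ?thesis .
  qed (use zero_mem conv_notin in auto)
qed

end

section \<open>Rings of functions on a weighted monoid\<close>

text \<open>The map \<open>h\<close> reads off coefficients: it is the identity for semigroup rings
  and uncurrying for power series rings. Injectivity transports the ring laws from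
  \<open>conv\<close>; the full image provides negatives, inverses and preimages of prescribed
  coefficient functions.\<close>

locale convolution_ring = weighted_monoid E wt
  for E :: "'a::comm_monoid_add set" and wt +
  fixes A (structure) and h :: "'b \<Rightarrow> 'a \<Rightarrow> 'k::field"
  assumes inj_h: "inj_on h (carrier A)"
    and image_h: "h ` carrier A = {f. \<forall>x. f x \<noteq> 0 \<longrightarrow> x \<in> E}"
    and mult_closed: "x \<in> carrier A \<Longrightarrow> y \<in> carrier A \<Longrightarrow> x \<otimes> y \<in> carrier A"
    and h_mult: "x \<in> carrier A \<Longrightarrow> y \<in> carrier A \<Longrightarrow> h (x \<otimes> y) = conv (h x) (h y)"
    and add_closed: "x \<in> carrier A \<Longrightarrow> y \<in> carrier A \<Longrightarrow> x \<oplus> y \<in> carrier A"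
    and h_add: "x \<in> carrier A \<Longrightarrow> y \<in> carrier A \<Longrightarrow> h (x \<oplus> y) = (\<lambda>e. h x e + h y e)"
    and one_closed: "\<one> \<in> carrier A" and h_one: "h \<one> = (\<lambda>x. if x = 0 then 1 else 0)"
    and zero_closed: "\<zero> \<in> carrier A" and h_zero: "h \<zero> = (\<lambda>_. 0)"
begin

lemma h_eqI: "x \<in> carrier A \<Longrightarrow> y \<in> carrier A \<Longrightarrow> h x = h y \<Longrightarrow> x = y"
  using inj_h by (auto dest: inj_onD)

lemma h_memD: "x \<in> carrier A \<Longrightarrow> h x e \<noteq> 0 \<Longrightarrow> e \<in> E"
  using image_h by blast

lemma h_surj:
  assumes "\<And>x. f x \<noteq> 0 \<Longrightarrow> x \<in> E"
  obtains y where "y \<in> carrier A" "h y = f"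
  using assms image_h by (smt (verit) imageE mem_Collect_eq)

lemma cring: "cring A"
proof (rule cringI)
  show "abelian_group A"
  proof (rule abelian_groupI)
    fix x assume x: "x \<in> carrier A"
    obtain y where "y \<in> carrier A" "h y = (\<lambda>e. - h x e)"
      by (rule h_surj[of "\<lambda>e. - h x e"]) (use h_memD x in auto)
    then have "y \<oplus> x = \<zero>"
      using x by (intro h_eqI) (auto simp: add_closed h_add zero_closed h_zero)
    then show "\<exists>y\<in>carrier A. y \<oplus> x = \<zero>" using \<open>y \<in> carrier A\<close> by blast
  qed (auto intro!: h_eqI simp: add_closed zero_closed h_add h_zero add_ac)
  show "comm_monoid A"
  proof (rule comm_monoidI)
    fix x y assume "x \<in> carrier A" "y \<in> carrier A"
    then show "x \<otimes> y = y \<otimes> x"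
      by (auto intro!: h_eqI simp: mult_closed h_mult conv_commute)
  next
    fix x assume "x \<in> carrier A"
    then show "\<one> \<otimes> x = x"
      by (auto intro!: h_eqI conv_one_left simp: mult_closed one_closed h_mult h_one h_memD)
  qed (auto intro!: h_eqI simp: mult_closed one_closed h_mult conv_assoc)
qed (auto intro!: h_eqI simp: mult_closed add_closed h_mult h_add conv_add_left)

sublocale cring A
  by (rule cring)

text \<open>Vanishing of the constant term is the criterion; \<open>unit_if_notin_nonunits\<close>
  justifies the name, since all other elements have an inverse by
  \<open>conv_inverse\<close>.\<close>

definition nonunits :: "'b set" where
  "nonunits = {x \<in> carrier A. h x 0 = 0}"

lemma h_uminus: "x \<in> carrier A \<Longrightarrow> h (\<ominus> x) = (\<lambda>e. - h x e)"
proof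
  fix e assume x: "x \<in> carrier A"
  then have "h (\<ominus> x \<oplus> x) e = 0" by (simp add: l_neg h_zero)
  with x show "h (\<ominus> x) e = - h x e" by (simp add: h_add eq_neg_iff_add_eq_0)
qed

lemma ideal_nonunits: "ideal nonunits A"
proof (rule idealI)
  show "subgroup nonunits (add_monoid A)"
  proof (rule subgroup.intro)
    fix x assume "x \<in> nonunits"
    then show "inv\<^bsub>add_monoid A\<^esub> x \<in> nonunits"
      using h_uminus a_inv_closed by (simp add: nonunits_def flip: a_inv_def)
  qed (auto simp: nonunits_def h_add h_zero)
qed (auto simp: nonunits_def h_mult conv_at_0 ring_axioms)

lemma unit_if_notin_nonunits:
  assumes "x \<in> carrier A" "x \<notin> nonunits"
  obtains y where "y \<in> carrier A" "x \<otimes> y = \<one>"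
proof -
  obtain y where "y \<in> carrier A" "h y = conv_inverse (h x)"
    by (rule h_surj[of "conv_inverse (h x)"]) (use conv_inverse_notin in fastforce)
  moreover from this have "x \<otimes> y = \<one>"
    using assms by (intro h_eqI) (auto simp: h_mult h_one nonunits_def conv_conv_inverse)
  ultimately show ?thesis using that by blast
qed

lemma proper_ideal_subset:
  assumes I: "ideal I A" and "I \<noteq> carrier A"
  shows "I \<subseteq> nonunits"
proof
  interpret I: ideal I A by fact
  fix x assume x: "x \<in> I"
  show "x \<in> nonunits"
  proof (rule ccontr)
    assume "x \<notin> nonunits"
    with x obtain y where "y \<in> carrier A" "x \<otimes> y = \<one>"
      using unit_if_notin_nonunits I.Icarr by metis
    then have "\<one> \<in> I" using I.I_r_closed[OF x] by force
    then show False using I.one_imp_carrier assms(2) by blast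
  qed
qed

lemma nonunits_neq_carrier: "nonunits \<noteq> carrier A"
proof -
  have "\<one> \<in> carrier A" "\<one> \<notin> nonunits" by (auto simp: nonunits_def h_one)
  then show ?thesis by blast
qed

text \<open>An ideal with an element outside \<open>nonunits\<close> contains a unit, so every
  proper ideal lies in \<open>nonunits\<close>. The equivalence also turns locality of a
  homomorphism into a statement about constant terms.\<close>

lemma maximalideal_iff: "maximalideal I A \<longleftrightarrow> I = nonunits"
proof
  assume "maximalideal I A"
  then interpret maximalideal I A .
  have "nonunits = I \<or> nonunits = carrier A"
    using I_notcarr ideal_nonunits proper_ideal_subset[OF ideal_axioms]
    by (intro I_maximal) (auto simp: nonunits_def)
  then show "I = nonunits" using nonunits_neq_carrier by blast
next
  assume "I = nonunits"
  moreover have "maximalideal nonunits A"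
  proof (rule maximalidealI[OF ideal_nonunits])
    show "carrier A \<noteq> nonunits" using nonunits_neq_carrier by simp
  qed (use proper_ideal_subset in blast)
  ultimately show "maximalideal I A" by simp
qed

lemma local_ring: "local_ring A"
  using cring maximalideal_iff by (auto simp: local_ring_def)

end

section \<open>Semigroup rings and power series rings over them\<close>

lemma add_submonoid_numerical_semigroup:
  assumes "numerical_semigroup S"
  shows "add_submonoid S"
proof -
  have "add_submonoid (\<Inter>T)" if "Ball T add_submonoid" for T :: "rat set set"
    using that by (simp add: add_submonoid_def)
  then have "add_submonoid (add_submonoid hull G)" for G :: "rat set"
    by (rule hull_in)
  then show ?thesis using assms unfolding numerical_semigroup_def by metis
qed

lemma common_denominator:
  assumes "finite G" "\<And>g :: rat. g \<in> G \<Longrightarrow> 0 < g"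
  shows "\<exists>N::nat. 0 < N \<and> (\<forall>g\<in>G. \<exists>k::nat. g = of_nat k / of_nat N)"
  using assms
proof (induction G)
  case empty
  show ?case by auto
next
  case (insert g G)
  then obtain N :: nat where N: "0 < N" "\<And>g. g \<in> G \<Longrightarrow> \<exists>k::nat. g = of_nat k / of_nat N"
    by auto
  obtain p q where pq: "quotient_of g = (p, q)" by force
  then have g: "g = of_int p / of_int q" "0 < q"
    using quotient_of_div quotient_of_denom_pos by blast+
  with insert.prems[of g] have "0 < p" by (simp add: zero_less_divide_iff)
  have "\<exists>k::nat. x = of_nat k / of_nat (N * nat q)" if x: "x \<in> insert g G" for x
  proof (cases "x = g")
    case True
    then have "x = of_nat (N * nat p) / of_nat (N * nat q)"
      using g N \<open>0 < p\<close> by (simp add: field_simps)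
    then show ?thesis by blast
  next
    case False
    with x N obtain k :: nat where "x = of_nat k / of_nat N" by auto
    then have "x = of_nat (k * nat q) / of_nat (N * nat q)" using g N by simp
    then show ?thesis by blast
  qed
  then show ?case using N g by (intro exI[of _ "N * nat q"]) auto
qed

text \<open>The fractions with denominator \<open>N\<close> and natural numerator form a submonoid
  containing the generators, hence the hull. This makes exponents into natural numbers, on which
  induction is possible.\<close>

lemma numerical_semigroup_denominator:
  assumes "numerical_semigroup S"
  obtains N :: nat where "0 < N" "\<forall>x\<in>S. \<exists>k::nat. x = of_nat k / of_nat N"
proof -
  obtain G where G: "finite G" "\<And>g. g \<in> G \<Longrightarrow> 0 < g" "S = add_submonoid hull G"
    using assms unfolding numerical_semigroup_def by blast
  obtain N :: nat where N: "0 < N" "\<forall>g\<in>G. \<exists>k::nat. g = of_nat k / of_nat N"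
    using common_denominator[OF G(1,2)] by blast
  have "\<exists>k::nat. 0 = of_nat k / (of_nat N :: rat)" by (intro exI[of _ 0]) simp
  moreover have "\<exists>k::nat. of_nat i / of_nat N + of_nat j / of_nat N = of_nat k / (of_nat N :: rat)"
    for i j :: nat by (intro exI[of _ "i + j"]) (simp add: add_divide_distrib)
  ultimately have "add_submonoid {x :: rat. \<exists>k::nat. x = of_nat k / of_nat N}"
    unfolding add_submonoid_def by blast
  then have "S \<subseteq> {x. \<exists>k::nat. x = of_nat k / of_nat N}"
    unfolding G(3) using N(2) by (intro hull_minimal) auto
  then show ?thesis using N(1) that by blast
qed

text \<open>On exponents with denominator \<open>N\<close> the product \<open>N x\<close> is already
  a natural number; \<open>nat\<close> and the floor only adjust the type.\<close>

definition scaled :: "nat \<Rightarrow> rat \<Rightarrow> nat" where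
  "scaled N x = nat \<lfloor>of_nat N * x\<rfloor>"

locale semigroup_with_denominator =
  fixes S :: "rat set" and N :: nat
  assumes submonoid: "add_submonoid S" and N_pos: "0 < N"
    and denominator: "x \<in> S \<Longrightarrow> \<exists>k::nat. x = of_nat k / of_nat N"
begin

lemma of_nat_scaled: "x \<in> S \<Longrightarrow> of_nat (scaled N x) = of_nat N * x"
  using denominator[of x] N_pos by (auto simp: scaled_def)

lemma nonneg: "x \<in> S \<Longrightarrow> 0 \<le> x"
  using denominator[of x] by auto

lemma inj_scaled: "x \<in> S \<Longrightarrow> y \<in> S \<Longrightarrow> scaled N x = scaled N y \<longleftrightarrow> x = y"
  using of_nat_scaled[of x] of_nat_scaled[of y] N_pos by (metis mult_left_cancel of_nat_eq_0_iff less_irrefl)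

sublocale weighted_monoid S "scaled N"
proof
  show "0 \<in> S" using submonoid by (simp add: add_submonoid_def)
  fix x y assume x: "x \<in> S"
  { assume y: "y \<in> S"
    show mem: "x + y \<in> S" using submonoid x y by (simp add: add_submonoid_def)
    have "of_nat (scaled N (x + y)) = (of_nat (scaled N x + scaled N y) :: rat)"
      using x y mem by (simp add: of_nat_scaled distrib_left)
    then show "scaled N (x + y) = scaled N x + scaled N y" by (simp only: of_nat_eq_iff) }
  show "x = 0" if "scaled N x = 0" using of_nat_scaled[OF x] that N_pos by simp
next
  fix d
  have "x = of_nat d / of_nat N" if "x \<in> S" "scaled N x = d" for x
    using of_nat_scaled[OF that(1)] that(2) N_pos by simp
  then have "{x \<in> S. scaled N x = d} \<subseteq> {of_nat d / of_nat N}" by blast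
  then show "finite {x \<in> S. scaled N x = d}" using finite_subset by blast
qed

lemma ns_ring_mult_eq_conv:
  assumes "\<And>x. f x \<noteq> 0 \<Longrightarrow> x \<in> S" "\<And>x. g x \<noteq> 0 \<Longrightarrow> x \<in> S"
  shows "f \<otimes>\<^bsub>ns_ring T\<^esub> g = conv f g"
proof
  fix d
  have "(\<Sum>a | f a \<noteq> 0 \<and> g (d - a) \<noteq> 0. f a * g (d - a))
      = (\<Sum>p\<in>{p \<in> splits d. f (fst p) \<noteq> 0 \<and> g (snd p) \<noteq> 0}. f (fst p) * g (snd p))"
    by (rule sum.reindex_bij_witness[where i = fst and j = "\<lambda>a. (a, d - a)"])
      (use assms in \<open>auto simp: splits_def\<close>)
  also have "\<dots> = conv f g d"
    unfolding conv_def case_prod_beta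
    by (rule sum.mono_neutral_left) (auto simp: finite_splits)
  finally show "(f \<otimes>\<^bsub>ns_ring T\<^esub> g) d = conv f g d" by (simp add: ns_ring_def)
qed

lemma carrier_ns_ring: "carrier (ns_ring S) = {f. \<forall>x. f x \<noteq> 0 \<longrightarrow> x \<in> S}"
  by (simp add: ns_ring_def)

lemma convolution_ring_ns_ring: "convolution_ring S (scaled N) (ns_ring S) (\<lambda>f. f)"
proof unfold_locales
  fix f g :: "rat \<Rightarrow> 'k::field"
  assume fg: "f \<in> carrier (ns_ring S)" "g \<in> carrier (ns_ring S)"
  then show *: "f \<otimes>\<^bsub>ns_ring S\<^esub> g = conv f g"
    by (intro ns_ring_mult_eq_conv) (auto simp: carrier_ns_ring)
  show "f \<otimes>\<^bsub>ns_ring S\<^esub> g \<in> carrier (ns_ring S)"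
    unfolding * using conv_notin by (auto simp: carrier_ns_ring)
  show "f \<oplus>\<^bsub>ns_ring S\<^esub> g = (\<lambda>e. f e + g e)" by (simp add: ns_ring_def)
  show "f \<oplus>\<^bsub>ns_ring S\<^esub> g \<in> carrier (ns_ring S)"
    using fg by (auto simp: ns_ring_def) (metis add.right_neutral)
qed (use zero_mem in \<open>auto simp: ns_ring_def\<close>)

text \<open>Coefficients of a product of power series are sums formed in \<open>R\<close> by
  \<open>finsum\<close>; this makes them ordinary sums over the field.\<close>

lemma finsum_ns_ring:
  fixes F :: "'i \<Rightarrow> rat \<Rightarrow> 'k::field"
  assumes "finite J" "F \<in> J \<rightarrow> carrier (ns_ring S)"
  shows "finsum (ns_ring S) F J = (\<lambda>d. \<Sum>i\<in>J. F i d)"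
proof -
  interpret R: convolution_ring S "scaled N" "ns_ring S :: (rat \<Rightarrow> 'k) ring" "\<lambda>f. f"
    by (rule convolution_ring_ns_ring)
  show ?thesis using assms
  proof (induction J)
    case empty
    then show ?case by (simp add: R.h_zero)
  next
    case (insert i J)
    then have F: "F i \<in> carrier (ns_ring S)" "F \<in> J \<rightarrow> carrier (ns_ring S)" by auto
    then have "finsum (ns_ring S) F (insert i J) = F i \<oplus>\<^bsub>ns_ring S\<^esub> finsum (ns_ring S) F J"
      using insert.hyps by (simp add: R.finsum_insert)
    also have "\<dots> = (\<lambda>d. F i d + finsum (ns_ring S) F J d)"
      using F by (intro R.h_add R.finsum_closed)
    finally show ?case using insert.hyps insert.IH[OF F(2)] by simp
  qed
qed

end

lemma u_pow_mult: "u_pow a \<otimes>\<^bsub>ns_ring T\<^esub> u_pow b = u_pow (a + b)"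
proof
  fix d
  have "{x. u_pow a x \<noteq> (0 :: 'a) \<and> u_pow b (d - x) \<noteq> (0 :: 'a)} = (if d = a + b then {a} else {})"
    by (auto simp: u_pow_def)
  then show "(u_pow a \<otimes>\<^bsub>ns_ring T\<^esub> u_pow b) d = (u_pow (a + b) d :: 'a)"
    by (simp add: ns_ring_def u_pow_def)
qed

lemma u_pow_one: "u_pow 0 = \<one>\<^bsub>ns_ring T\<^esub>"
  by (simp add: u_pow_def ns_ring_def)

lemma u_pow_inject: "(u_pow a :: rat \<Rightarrow> 'k::field) = u_pow b \<longleftrightarrow> a = b"
  by (auto simp: u_pow_def fun_eq_iff split: if_splits)

section \<open>Monomials of the power series ring over a semigroup ring\<close>

lemma finite_submultisets: "finite {B. B \<subseteq># A}"
proof (rule finite_subset)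
  show "{B. B \<subseteq># A} \<subseteq> (\<Union>k\<le>size A. multisets_of_size (set_mset A) k)"
    by (auto simp: multisets_of_size_def size_mset_mono dest: mset_subset_eqD)
qed auto

lemma sum_mset_image_eq_sum_count:
  fixes f :: "nat \<Rightarrow> 'a::comm_semiring_1"
  assumes "set_mset A \<subseteq> {..<n}"
  shows "(\<Sum>i\<in>#A. f i) = (\<Sum>i<n. of_nat (count A i) * f i)"
  using assms
proof (induction A)
  case (add x A)
  then have "(\<Sum>i<n. of_nat (count (add_mset x A) i) * f i)
      = (\<Sum>i<n. (if i = x then f i else 0) + of_nat (count A i) * f i)"
    by (intro sum.cong) (auto simp: distrib_right)
  with add show ?case by (simp add: sum.distrib)
qed simp

text \<open>The condition \<open>s i \<noteq> 0\<close> gives every variable positive weight.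
  Without it infinitely many monomials could share one degree, and the substitution for the
  variables would need infinite sums.\<close>

locale semigroup_extension = ext: semigroup_with_denominator S' N
  for S' N +
  fixes S :: "rat set" and n :: nat and s :: "nat \<Rightarrow> rat"
  assumes base_submonoid: "add_submonoid S" and base_subset: "S \<subseteq> S'"
    and s_mem: "i < n \<Longrightarrow> s i \<in> S'" and s_nonzero: "i < n \<Longrightarrow> s i \<noteq> 0"
begin

sublocale base: semigroup_with_denominator S N
  by unfold_locales (use base_submonoid base_subset ext.denominator ext.N_pos in auto)

text \<open>The pair \<open>(A, a)\<close> stands for the monomial \<open>u\<^sup>a Y\<^sup>A\<close>, whose image has degree \<open>degree (A, a)\<close>.\<close>

definition monomials :: "(nat multiset \<times> rat) set" where
  "monomials = {A. set_mset A \<subseteq> {..<n}} \<times> S"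

definition degree :: "nat multiset \<times> rat \<Rightarrow> rat" where
  "degree x = (\<Sum>i\<in>#fst x. s i) + snd x"

abbreviation weight :: "nat multiset \<times> rat \<Rightarrow> nat" where
  "weight x \<equiv> scaled N (degree x)"

lemma mem_monomials: "(A, a) \<in> monomials \<longleftrightarrow> set_mset A \<subseteq> {..<n} \<and> a \<in> S"
  by (simp add: monomials_def)

lemma degree_add: "degree (x + y) = degree x + degree y"
  by (simp add: degree_def)

lemma sum_mset_s_mem: "set_mset A \<subseteq> {..<n} \<Longrightarrow> (\<Sum>i\<in>#A. s i) \<in> S'"
  by (induction A) (auto simp: ext.zero_mem ext.add_mem s_mem)

lemma degree_mem: "x \<in> monomials \<Longrightarrow> degree x \<in> S'"
  using base_subset by (auto simp: monomials_def degree_def ext.add_mem sum_mset_s_mem)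

text \<open>Each variable has weight at least one. The bound on the number of factors leaves
  finitely many monomials of a given weight.\<close>

lemma size_le_scaled: "set_mset A \<subseteq> {..<n} \<Longrightarrow> size A \<le> scaled N (\<Sum>i\<in>#A. s i)"
proof (induction A)
  case (add i A)
  then have "s i \<in> S'" "s i \<noteq> 0" "(\<Sum>i\<in>#A. s i) \<in> S'"
    using s_mem s_nonzero sum_mset_s_mem by auto
  moreover from this have "scaled N (s i) \<noteq> 0" using ext.wt_eq_0D by blast
  ultimately show ?case using add by (simp add: ext.wt_add)
qed simp

sublocale mon: weighted_monoid monomials weight
proof
  show "0 \<in> monomials" by (simp add: monomials_def zero_prod_def base.zero_mem)
  fix x y assume x: "x \<in> monomials"
  have weight: "weight x = scaled N (\<Sum>i\<in>#fst x. s i) + scaled N (snd x)"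
    if "x \<in> monomials" for x
    using that base_subset by (auto simp: monomials_def degree_def ext.wt_add sum_mset_s_mem)
  { assume y: "y \<in> monomials"
    show "x + y \<in> monomials" using x y by (auto simp: monomials_def base.add_mem)
    show "weight (x + y) = weight x + weight y"
      using x y by (simp add: degree_add ext.wt_add degree_mem) }
  show "x = 0" if "weight x = 0"
  proof -
    have "size (fst x) = 0" "scaled N (snd x) = 0"
      using that weight[OF x] size_le_scaled[of "fst x"] x by (auto simp: monomials_def)
    then show ?thesis using x base.wt_eq_0D by (auto simp: monomials_def prod_eq_iff)
  qed
next
  fix d
  have "size A \<le> d \<and> scaled N a \<le> d"
    if "set_mset A \<subseteq> {..<n}" "a \<in> S" "weight (A, a) = d" for A a
  proof -
    have "weight (A, a) = scaled N (\<Sum>i\<in>#A. s i) + scaled N a"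
      using that base_subset by (auto simp: degree_def ext.wt_add sum_mset_s_mem)
    then show ?thesis using that size_le_scaled[of A] by simp
  qed
  then have "{x \<in> monomials. weight x = d}
      \<subseteq> (\<Union>k\<le>d. multisets_of_size {..<n} k) \<times> {a \<in> S. scaled N a \<le> d}"
    by (auto simp: monomials_def multisets_of_size_def)
  then show "finite {x \<in> monomials. weight x = d}"
    by (rule finite_subset) (intro finite_cartesian_product base.finite_wt_le finite_UN_I, auto)
qed

lemma weight_eq_iff: "x \<in> monomials \<Longrightarrow> y \<in> monomials \<Longrightarrow> weight x = weight y \<longleftrightarrow> degree x = degree y"
  by (simp add: ext.inj_scaled degree_mem)

text \<open>A series whose coefficients are series in \<open>u\<close> is one field-valued function
  on the monomials in \<open>u\<close> and \<open>Y\<close> together. The nested product, over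
  submultisets outside and exponents inside, becomes a single sum over splittings of
  \<open>(A, a)\<close>.\<close>

lemma convolution_ring_power_series_ring:
  "convolution_ring monomials weight
     (power_series_ring (ns_ring S :: (rat \<Rightarrow> 'k::field) ring) n) (\<lambda>f (A, a). f A a)"
proof -
  interpret R: convolution_ring S "scaled N" "ns_ring S :: (rat \<Rightarrow> 'k) ring" "\<lambda>f. f"
    by (rule base.convolution_ring_ns_ring)
  let ?R = "ns_ring S :: (rat \<Rightarrow> 'k) ring"
  let ?P = "power_series_ring ?R n"
  have carrier_P: "f \<in> carrier ?P \<longleftrightarrow> (\<forall>A a. f A a \<noteq> 0 \<longrightarrow> (A, a) \<in> monomials)" for f
    by (fastforce simp: power_series_ring_def mem_monomials base.carrier_ns_ring R.h_zero)
  have carrier_PD: "f A \<in> carrier ?R" if "f \<in> carrier ?P" for f A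
    using that by (simp add: power_series_ring_def)
  have const: "ring.indexed_const ?R r = (\<lambda>A. if A = {#} then r else \<zero>\<^bsub>?R\<^esub>)" for r
    by (simp add: R.indexed_const_def)
  have mult: "(f \<otimes>\<^bsub>?P\<^esub> g) A a = mon.conv (\<lambda>(A, a). f A a) (\<lambda>(A, a). g A a) (A, a)"
    if fg: "f \<in> carrier ?P" "g \<in> carrier ?P" for f g A a
  proof -
    have "(f \<otimes>\<^bsub>?P\<^esub> g) A a = (\<Sum>B | B \<subseteq># A. (f B \<otimes>\<^bsub>?R\<^esub> g (A - B)) a)"
      by (simp add: power_series_ring_def base.finsum_ns_ring finite_submultisets carrier_PD[OF fg(1)]
          carrier_PD[OF fg(2)])
    also have "\<dots> = (\<Sum>B | B \<subseteq># A. \<Sum>p\<in>base.splits a. f B (fst p) * g (A - B) (snd p))"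
      by (simp add: R.h_mult carrier_PD[OF fg(1)] carrier_PD[OF fg(2)] base.conv_def case_prod_beta)
    also have "\<dots> = (\<Sum>(B, p)\<in>{B. B \<subseteq># A} \<times> base.splits a. f B (fst p) * g (A - B) (snd p))"
      by (rule sum.cartesian_product)
    also have "\<dots> = (\<Sum>((B, b), (C, c))\<in>mon.splits (A, a). f B b * g C c)"
    proof (cases "set_mset A \<subseteq> {..<n}")
      case True
      have "set_mset B \<subseteq> {..<n} \<and> set_mset (A - B) \<subseteq> {..<n}" if "B \<subseteq># A" for B
        using True that by (auto dest: mset_subset_eqD in_diffD)
      then show ?thesis
        by (intro sum.reindex_bij_witness
            [where j = "\<lambda>(B, (b, c)). ((B, b), (A - B, c))" and i = "\<lambda>((B, b), (C, c)). (B, (b, c))"])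
          (auto simp: mon.splits_def base.splits_def mem_monomials)
    next
      \<comment> \<open>A variable outside the range occurs in \<open>B\<close> or in
        \<open>A - B\<close>, so a factor of each summand vanishes; on the other side there are no
        splittings.\<close>
      case False
      then have "(A, a) \<notin> monomials" by (simp add: mem_monomials)
      moreover have "f B b * g (A - B) c = 0" if "B \<subseteq># A" for B b c
      proof (rule ccontr)
        assume "f B b * g (A - B) c \<noteq> 0"
        then have "(B, b) \<in> monomials" "(A - B, c) \<in> monomials"
          using fg unfolding carrier_P by auto
        then have "set_mset B \<subseteq> {..<n}" "set_mset (A - B) \<subseteq> {..<n}"
          by (simp_all add: mem_monomials)
        then have "set_mset (B + (A - B)) \<subseteq> {..<n}" by simp
        with that False show False by (simp add: subset_mset.add_diff_inverse)
      qed
      ultimately show ?thesis by (auto simp: mon.splits_notin intro!: sum.neutral)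
    qed
    finally show ?thesis by (simp add: mon.conv_def case_prod_beta)
  qed
  show ?thesis
  proof (intro convolution_ring.intro convolution_ring_axioms.intro mon.weighted_monoid_axioms)
    show "inj_on (\<lambda>f (A, a). f A a) (carrier ?P)"
      by (rule inj_onI) (metis curry_case_prod)
    show "(\<lambda>f (A, a). f A a) ` carrier ?P = {f. \<forall>x. f x \<noteq> (0 :: 'k) \<longrightarrow> x \<in> monomials}"
    proof (intro equalityI subsetI)
      fix f :: "nat multiset \<times> rat \<Rightarrow> 'k"
      assume f: "f \<in> {f. \<forall>x. f x \<noteq> 0 \<longrightarrow> x \<in> monomials}"
      have "f = (\<lambda>g (A, a). g A a) (\<lambda>A a. f (A, a))" by auto
      with f show "f \<in> (\<lambda>f (A, a). f A a) ` carrier ?P"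
        by (intro image_eqI) (auto simp: carrier_P)
    qed (auto simp: carrier_P)
    fix f g assume fg: "f \<in> carrier ?P" "g \<in> carrier ?P"
    then show "(\<lambda>(A, a). (f \<otimes>\<^bsub>?P\<^esub> g) A a) = mon.conv (\<lambda>(A, a). f A a) (\<lambda>(A, a). g A a)"
      by (auto simp: mult)
    show "f \<otimes>\<^bsub>?P\<^esub> g \<in> carrier ?P"
      unfolding carrier_P mult[OF fg] using mon.conv_notin by blast
    have add: "(f \<oplus>\<^bsub>?P\<^esub> g) A a = f A a + g A a" for A a
      by (simp add: power_series_ring_def R.indexed_padd_def R.h_add carrier_PD[OF fg(1)]
          carrier_PD[OF fg(2)])
    then show "(\<lambda>(A, a). (f \<oplus>\<^bsub>?P\<^esub> g) A a) = (\<lambda>e. (case e of (A, a) \<Rightarrow> f A a) + (case e of (A, a) \<Rightarrow> g A a))"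
      by auto
    show "f \<oplus>\<^bsub>?P\<^esub> g \<in> carrier ?P"
    proof (unfold carrier_P add, intro allI impI)
      fix A a assume "f A a + g A a \<noteq> 0"
      then have "f A a \<noteq> 0 \<or> g A a \<noteq> 0" by auto
      then show "(A, a) \<in> monomials" using fg unfolding carrier_P by blast
    qed
  next
    show "(\<lambda>(A, a). \<one>\<^bsub>?P\<^esub> A a) = (\<lambda>x. if x = 0 then 1 else 0)"
      by (auto simp: power_series_ring_def const R.h_one R.h_zero zero_prod_def)
    show "(\<lambda>(A, a). \<zero>\<^bsub>?P\<^esub> A a) = (\<lambda>_. 0)"
      by (auto simp: power_series_ring_def const R.h_zero)
    show "\<one>\<^bsub>?P\<^esub> \<in> carrier ?P"
      unfolding carrier_P
      by (auto simp: power_series_ring_def const R.h_one R.h_zero mem_monomials base.zero_mem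
          split: if_splits)
    show "\<zero>\<^bsub>?P\<^esub> \<in> carrier ?P"
      unfolding carrier_P by (auto simp: power_series_ring_def const R.h_zero)
  qed
qed

end

section \<open>Balanced maps and flatness\<close>

text \<open>The carrier stays in the element type of \<open>R\<close>, as the test modules of
  \<open>flat_module\<close> require. The ideal \<open>carrier R\<close> gives \<open>R\<close> as a
  module over itself.\<close>

definition ideal_module :: "('r, 'a) ring_scheme \<Rightarrow> 'r set \<Rightarrow> ('r, 'r) module" where
  "ideal_module R I =
     \<lparr>carrier = I, monoid.mult = monoid.mult R, monoid.one = monoid.one R, ring.zero = ring.zero R,
      ring.add = ring.add R, smult = monoid.mult R\<rparr>"

lemma module_ideal_module:
  assumes "cring R" "ideal I R"
  shows "module R (ideal_module R I)"
proof -
  interpret cring R by fact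
  interpret I: ideal I R by fact
  show ?thesis
  proof (rule moduleI)
    show "abelian_group (ideal_module R I)"
    proof (rule abelian_groupI)
      fix x assume "x \<in> carrier (ideal_module R I)"
      then have "\<ominus>\<^bsub>R\<^esub> x \<in> I" "\<ominus>\<^bsub>R\<^esub> x \<oplus>\<^bsub>R\<^esub> x = \<zero>\<^bsub>R\<^esub>"
        by (auto simp: ideal_module_def l_neg I.Icarr I.a_inv_closed)
      then show "\<exists>y\<in>carrier (ideal_module R I). y \<oplus>\<^bsub>ideal_module R I\<^esub> x = \<zero>\<^bsub>ideal_module R I\<^esub>"
        by (auto simp: ideal_module_def)
    qed (auto simp: ideal_module_def I.Icarr I.a_closed I.zero_closed a_ac)
  qed (auto simp: ideal_module_def I.Icarr I.I_l_closed l_distr r_distr m_assoc assms)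
qed

text \<open>Induction over \<open>generate\<close> in additive form. Inclusion of \<open>Z\<close>
  in the carrier is what identifies the group inverse of a generator with its negative.\<close>

lemma generate_free_Abelian_group_induct:
  assumes "c \<in> generate (free_Abelian_group J) Z" "Z \<subseteq> carrier (free_Abelian_group J)"
    and "Q 0" "\<And>z. z \<in> Z \<Longrightarrow> Q z" "\<And>x. Q x \<Longrightarrow> Q (- x)" "\<And>x y. Q x \<Longrightarrow> Q y \<Longrightarrow> Q (x + y)"
  shows "Q c"
  using assms(1)
proof induction
  case (inv z)
  then have "inv\<^bsub>free_Abelian_group J\<^esub> z = - z" using assms(2) by auto
  then show ?case using assms(4,5) inv by simp
qed (use assms(3-) in auto)

text \<open>The homomorphism on the free abelian group that extends \<open>\<phi>\<close>, as given
  by the universal property, with values in the additive group of a ring.\<close>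

definition frag_value :: "('b \<Rightarrow> 'v::ring_1) \<Rightarrow> ('b \<Rightarrow>\<^sub>0 int) \<Rightarrow> 'v" where
  "frag_value \<phi> c = (\<Sum>z\<in>Poly_Mapping.keys c. of_int (Poly_Mapping.lookup c z) * \<phi> z)"

lemma frag_value_superset:
  assumes "finite J" "Poly_Mapping.keys c \<subseteq> J"
  shows "frag_value \<phi> c = (\<Sum>z\<in>J. of_int (Poly_Mapping.lookup c z) * \<phi> z)"
  unfolding frag_value_def
  by (rule sum.mono_neutral_left) (use assms in \<open>auto simp: in_keys_iff\<close>)

lemma frag_value_add: "frag_value \<phi> (x + y) = frag_value \<phi> x + frag_value \<phi> y"
proof -
  let ?J = "Poly_Mapping.keys x \<union> Poly_Mapping.keys y"
  have "Poly_Mapping.keys (x + y) \<subseteq> ?J" by (rule keys_add)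
  then show ?thesis
    by (simp add: frag_value_superset[of ?J] lookup_add distrib_right sum.distrib)
qed

lemma frag_value_minus: "frag_value \<phi> (- x) = - frag_value \<phi> x"
proof -
  have "frag_value \<phi> (- x + x) = frag_value \<phi> (- x) + frag_value \<phi> x" by (rule frag_value_add)
  then show ?thesis by (simp add: frag_value_def eq_neg_iff_add_eq_0)
qed

lemma frag_value_diff: "frag_value \<phi> (x - y) = frag_value \<phi> x - frag_value \<phi> y"
  using frag_value_add[of \<phi> x "- y"] by (simp add: frag_value_minus)

lemma frag_value_of: "frag_value \<phi> (frag_of z) = \<phi> z"
  by (simp add: frag_value_def keys_frag_of)

lemma frag_of_mem: "z \<in> J \<Longrightarrow> frag_of z \<in> carrier (free_Abelian_group J)"
  by simp

section \<open>Flatness and balanced biadditive maps\<close>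

definition tensor_relators ::
  "('r, 'a) ring_scheme \<Rightarrow> ('r, 'm, 'b) module_scheme \<Rightarrow> ('r, 'n, 'c) module_scheme
     \<Rightarrow> ('m \<times> 'n \<Rightarrow>\<^sub>0 int) set" where
  "tensor_relators R M P =
     {frag_of (x \<oplus>\<^bsub>M\<^esub> x', y) - frag_of (x, y) - frag_of (x', y) | x x' y.
         x \<in> carrier M \<and> x' \<in> carrier M \<and> y \<in> carrier P} \<union>
      {frag_of (x, y \<oplus>\<^bsub>P\<^esub> y') - frag_of (x, y) - frag_of (x, y') | x y y'.
         x \<in> carrier M \<and> y \<in> carrier P \<and> y' \<in> carrier P} \<union>
      {frag_of (r \<odot>\<^bsub>M\<^esub> x, y) - frag_of (x, r \<odot>\<^bsub>P\<^esub> y) | r x y.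
         r \<in> carrier R \<and> x \<in> carrier M \<and> y \<in> carrier P}"

lemma tensor_relations_eq: "tensor_relations R M P = generate (tensor_free M P) (tensor_relators R M P)"
  by (simp add: tensor_relations_def tensor_relators_def)

lemma tensor_relators_subset:
  assumes "module R M" "module R P"
  shows "tensor_relators R M P \<subseteq> carrier (tensor_free M P)"
proof -
  interpret M: module R M by fact
  interpret P: module R P by fact
  have diff: "x - y \<in> carrier (tensor_free M P)"
    if "x \<in> carrier (tensor_free M P)" "y \<in> carrier (tensor_free M P)" for x y
    using that keys_diff[of x y] by auto
  show ?thesis
    unfolding tensor_relators_def
    by (intro Un_least subsetI; clarsimp simp del: carrier_free_Abelian_group_iff;
        intro diff frag_of_mem) auto
qed

text \<open>In the tensor product of \<open>R\<close> with \<open>P\<close> both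
  \<open>x \<otimes> p\<close> and \<open>y \<otimes> q\<close> equal
  \<open>1 \<otimes> x p\<close>. Flatness, tested on the inclusion of \<open>I\<close> into
  \<open>R\<close>, pulls the equality back to the tensor product of \<open>I\<close> with
  \<open>P\<close>, through which \<open>\<phi>\<close> factors.\<close>

lemma flat_module_balanced:
  fixes R :: "('r, 'a) ring_scheme" and P :: "('r, 'p, 'b) module_scheme"
    and \<phi> :: "'r \<times> 'p \<Rightarrow> 'v::ring_1"
  assumes flat: "flat_module R P" and R: "cring R" and I: "ideal I R"
    and mem: "x \<in> I" "y \<in> I" "p \<in> carrier P" "q \<in> carrier P"
    and eq: "x \<odot>\<^bsub>P\<^esub> p = y \<odot>\<^bsub>P\<^esub> q"
    and add1: "\<And>x x' p. x \<in> I \<Longrightarrow> x' \<in> I \<Longrightarrow> p \<in> carrier P \<Longrightarrow> \<phi> (x \<oplus>\<^bsub>R\<^esub> x', p) = \<phi> (x, p) + \<phi> (x', p)"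
    and add2: "\<And>x p p'. x \<in> I \<Longrightarrow> p \<in> carrier P \<Longrightarrow> p' \<in> carrier P \<Longrightarrow> \<phi> (x, p \<oplus>\<^bsub>P\<^esub> p') = \<phi> (x, p) + \<phi> (x, p')"
    and balanced: "\<And>r x p. r \<in> carrier R \<Longrightarrow> x \<in> I \<Longrightarrow> p \<in> carrier P \<Longrightarrow> \<phi> (r \<otimes>\<^bsub>R\<^esub> x, p) = \<phi> (x, r \<odot>\<^bsub>P\<^esub> p)"
  shows "\<phi> (x, p) = \<phi> (y, q)"
proof -
  interpret cring R by fact
  interpret I: ideal I R by fact
  let ?M = "ideal_module R I" and ?N = "ideal_module R (carrier R)"
  let ?K = "tensor_relations R ?M P" and ?L = "tensor_relations R ?N P"
  let ?G = "tensor_free ?M P" and ?H = "tensor_free ?N P"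
  have P: "module R P" using flat by (simp add: flat_module_def)
  have M: "module R ?M" by (rule module_ideal_module[OF R I])
  have N: "module R ?N" by (rule module_ideal_module[OF R oneideal])
  interpret H: group ?H by simp
  interpret G: group ?G by simp
  have carr: "carrier ?M = I" "carrier ?N = carrier R" by (simp_all add: ideal_module_def)
  have subM: "tensor_relators R ?M P \<subseteq> carrier ?G" by (rule tensor_relators_subset[OF M P])
  have subN: "tensor_relators R ?N P \<subseteq> carrier ?H" by (rule tensor_relators_subset[OF N P])
  have L: "subgroup ?L ?H"
    unfolding tensor_relations_eq by (rule H.generate_is_subgroup[OF subN])
  have K: "subgroup ?K ?G"
    unfolding tensor_relations_eq by (rule G.generate_is_subgroup[OF subM])
  have L_add: "a + b \<in> ?L" if "a \<in> ?L" "b \<in> ?L" for a b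
    using subgroup.m_closed[OF L that] by simp
  have L_minus: "- a \<in> ?L" if "a \<in> ?L" for a
  proof -
    have "a \<in> carrier ?H" using subgroup.subset[OF L] that by blast
    then show ?thesis using subgroup.m_inv_closed[OF L that] by simp
  qed
  have L_gen: "z \<in> ?L" if "z \<in> tensor_relators R ?N P" for z
    unfolding tensor_relations_eq using that by (rule generate.incl)
  have L_zero: "0 \<in> ?L" using subgroup.one_closed[OF L] by simp
  have K_zero: "0 \<in> ?K" using subgroup.one_closed[OF K] by simp
  have "tensor_relators R ?M P \<subseteq> tensor_relators R ?N P"
    unfolding tensor_relators_def carr using I.Icarr
    by (intro Un_mono; force simp: ideal_module_def)
  then have KL: "?K \<subseteq> ?L"
    using L_zero L_add L_minus L_gen
    by (auto simp: tensor_relations_eq[of R ?M] elim!: generate_free_Abelian_group_induct[OF _ subM])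
  \<comment> \<open>For the inclusion the extended map is the identity on formal sums, so the coset
    of \<open>a\<close> modulo \<open>?K\<close> goes to the coset of \<open>a\<close> modulo the
    larger subgroup \<open>?L\<close>.\<close>
  have shift: "tensor_map R ?N P (\<lambda>x. x) (?K #>\<^bsub>?G\<^esub> a) = {l + a | l. l \<in> ?L}" for a
  proof -
    have ext: "frag_extend (\<lambda>(x :: 'r, y :: 'p). frag_of (x, y)) = (\<lambda>c. c)"
    proof
      fix c :: "'r \<times> 'p \<Rightarrow>\<^sub>0 int"
      have "(\<lambda>(x, y). frag_of (x, y)) = (frag_of :: 'r \<times> 'p \<Rightarrow> _)" by auto
      then show "frag_extend (\<lambda>(x, y). frag_of (x, y)) c = c"
        using frag_expansion[of c] by argo
    qed
    have "tensor_map R ?N P (\<lambda>x. x) (?K #>\<^bsub>?G\<^esub> a) = {l + (k + a) | l k. l \<in> ?L \<and> k \<in> ?K}"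
      unfolding tensor_map_def ext by (auto simp: set_mult_def r_coset_def)
    also have "\<dots> = {l + a | l. l \<in> ?L}"
    proof (intro equalityI subsetI)
      fix z assume "z \<in> {l + (k + a) | l k. l \<in> ?L \<and> k \<in> ?K}"
      then obtain l k where "z = (l + k) + a" "l \<in> ?L" "k \<in> ?L" using KL by (auto simp: add.assoc)
      then show "z \<in> {l + a | l. l \<in> ?L}" using L_add by blast
    next
      fix z assume "z \<in> {l + a | l. l \<in> ?L}"
      then obtain l where "z = l + (0 + a)" "l \<in> ?L" by auto
      then show "z \<in> {l + (k + a) | l k. l \<in> ?L \<and> k \<in> ?K}" using K_zero by blast
    qed
    finally show ?thesis .
  qed
  let ?a = "frag_of (x, p)" and ?b = "frag_of (y, q)"
  \<comment> \<open>The balancing relator for the scalar \<open>z\<close> and the element 1, which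
    is available in \<open>?N\<close> though perhaps not in \<open>?M\<close>.\<close>
  have rel: "frag_of (z, w) - frag_of (\<one>\<^bsub>R\<^esub>, z \<odot>\<^bsub>P\<^esub> w) \<in> ?L" if "z \<in> I" "w \<in> carrier P" for z w
  proof (rule L_gen)
    have "frag_of (z, w) - frag_of (\<one>\<^bsub>R\<^esub>, z \<odot>\<^bsub>P\<^esub> w)
        = frag_of (z \<odot>\<^bsub>?N\<^esub> \<one>\<^bsub>R\<^esub>, w) - frag_of (\<one>\<^bsub>R\<^esub>, z \<odot>\<^bsub>P\<^esub> w)"
      using that I.Icarr by (simp add: ideal_module_def)
    then show "frag_of (z, w) - frag_of (\<one>\<^bsub>R\<^esub>, z \<odot>\<^bsub>P\<^esub> w) \<in> tensor_relators R ?N P"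
      unfolding tensor_relators_def carr using that I.Icarr one_closed by blast
  qed
  have ab: "?a - ?b \<in> ?L"
    using L_add[OF rel[OF mem(1,3)] L_minus[OF rel[OF mem(2,4)]]] eq by simp
  have "{l + ?a | l. l \<in> ?L} = {l + ?b | l. l \<in> ?L}"
  proof (intro equalityI subsetI)
    fix z assume "z \<in> {l + ?a | l. l \<in> ?L}"
    then obtain l where "z = (l + (?a - ?b)) + ?b" "l \<in> ?L" by auto
    then show "z \<in> {l + ?b | l. l \<in> ?L}" using ab L_add by blast
  next
    fix z assume "z \<in> {l + ?b | l. l \<in> ?L}"
    then obtain l where "z = (l + - (?a - ?b)) + ?a" "l \<in> ?L" by auto
    then show "z \<in> {l + ?a | l. l \<in> ?L}" using ab L_add L_minus by blast
  qed
  moreover have "(\<lambda>x. x) \<in> module_hom R ?M ?N"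
    using I.Icarr by (auto simp: module_hom_def ideal_module_def)
  then have "inj_on (tensor_map R ?N P (\<lambda>x. x)) (carrier (tensor_product R ?M P))"
    using flat M N unfolding flat_module_def by (metis inj_on_id2)
  moreover have "?K #>\<^bsub>?G\<^esub> ?a \<in> carrier (tensor_product R ?M P)"
    "?K #>\<^bsub>?G\<^esub> ?b \<in> carrier (tensor_product R ?M P)"
    using mem by (auto simp: tensor_product_def FactGroup_def RCOSETS_def carr)
  ultimately have "?K #>\<^bsub>?G\<^esub> ?a = ?K #>\<^bsub>?G\<^esub> ?b"
    unfolding shift[symmetric] by (simp only: inj_on_eq_iff)
  moreover have "?a \<in> ?K #>\<^bsub>?G\<^esub> ?a" using K_zero by (auto simp: r_coset_def)
  ultimately have "?a \<in> ?K #>\<^bsub>?G\<^esub> ?b" by metis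
  then obtain k where k: "k \<in> ?K" "?a = k + ?b" by (auto simp: r_coset_def)
  \<comment> \<open>The extension of \<open>\<phi>\<close> kills every relator and hence
    \<open>?K\<close>; evaluating \<open>?a = k + ?b\<close> then gives the claim.\<close>
  have "frag_value \<phi> k = 0"
    using k(1) unfolding tensor_relations_eq
  proof (rule generate_free_Abelian_group_induct[OF _ subM])
    fix z assume "z \<in> tensor_relators R ?M P"
    then show "frag_value \<phi> z = 0"
      unfolding tensor_relators_def carr
      by (auto simp: frag_value_diff frag_value_of ideal_module_def add1 add2 balanced)
  qed (auto simp: frag_value_def[of _ 0] frag_value_minus frag_value_add)
  then show ?thesis using k(2) by (metis add_0 frag_value_add frag_value_of)
qed

section \<open>Flatness and uniqueness of Apery decompositions\<close>

context semigroup_with_denominator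
begin

text \<open>Only the splitting \<open>(0, x)\<close> survives. This is how elements of
  \<open>R\<close> are seen to act on a chosen coefficient through their constant term.\<close>

lemma conv_eq_if_left_trivial:
  assumes "x \<in> S" "\<And>a b. (a, b) \<in> splits x \<Longrightarrow> f a \<noteq> 0 \<Longrightarrow> g b \<noteq> 0 \<Longrightarrow> a = 0"
  shows "conv f g x = f 0 * g x"
proof -
  have "conv f g x = (\<Sum>p\<in>{(0, x)}. f (fst p) * g (snd p))"
    unfolding conv_def case_prod_beta
  proof (rule sum.mono_neutral_right)
    show "{(0, x)} \<subseteq> splits x" using assms(1) zero_mem by (simp add: splits_def)
    show "\<forall>p\<in>splits x - {(0, x)}. f (fst p) * g (snd p) = 0"
    proof
      fix p assume p: "p \<in> splits x - {(0, x)}"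
      show "f (fst p) * g (snd p) = 0"
      proof (rule ccontr)
        assume "f (fst p) * g (snd p) \<noteq> 0"
        then have "fst p = 0" using p assms(2)[of "fst p" "snd p"] by simp
        with p show False by (auto simp: splits_def)
      qed
    qed
  qed (rule finite_splits)
  then show ?thesis by simp
qed

lemma conv_nonzeroE:
  assumes "conv f g x \<noteq> 0"
  obtains a b where "(a, b) \<in> splits x" "f a \<noteq> 0" "g b \<noteq> 0"
proof -
  have "\<exists>p\<in>splits x. f (fst p) * g (snd p) \<noteq> 0"
    using assms unfolding conv_def case_prod_beta by (meson sum.neutral)
  then show ?thesis using that by force
qed

end

locale nested_semigroups = ext: semigroup_with_denominator S' N + base: semigroup_with_denominator S N
  for S' S N +
  assumes subset: "S \<subseteq> S'"
begin

definition apery :: "rat set" where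
  "apery = {w \<in> S'. \<forall>a\<in>S. \<forall>b\<in>S'. w = a + b \<longrightarrow> a = 0}"

text \<open>
  If \<open>s1 - s2\<close> is not in \<open>S\<close>, then \<open>f \<otimes> g \<mapsto> f s1 * g w1\<close> is a well-defined functional on the tensor
  product of \<open>R'\<close> with the ideal of series supported in \<open>(s1 + S) \<union> (s2 + S)\<close>. It separates
  \<open>u\<^sup>s\<^sup>1 \<otimes> u\<^sup>w\<^sup>1\<close> from \<open>u\<^sup>s\<^sup>2 \<otimes> u\<^sup>w\<^sup>2\<close>, which have the same image in \<open>R'\<close>.
\<close>

lemma flat_imp_unique_decomposition:
  assumes flat: "flat_module (ns_ring S :: (rat \<Rightarrow> 'k::field) ring) (ring_as_module (ns_ring S'))"
    and s: "s1 \<in> S" "s2 \<in> S" and w: "w1 \<in> apery" "w2 \<in> apery" and eq: "s1 + w1 = s2 + w2"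
  shows "s1 = s2"
proof (cases "s1 - s2 \<in> S")
  \<comment> \<open>Here \<open>w2\<close> would split off \<open>s1 - s2\<close>, which the Apery
    property allows only for 0.\<close>
  case True
  moreover have "w2 = (s1 - s2) + w1" using eq by simp
  moreover have "w1 \<in> S'" using w by (simp add: apery_def)
  ultimately have "s1 - s2 = 0" using w(2) unfolding apery_def by blast
  then show ?thesis by simp
next
  case False
  let ?R = "ns_ring S :: (rat \<Rightarrow> 'k) ring" and ?R' = "ns_ring S' :: (rat \<Rightarrow> 'k) ring"
  interpret R: convolution_ring S "scaled N" ?R "\<lambda>f. f" by (rule base.convolution_ring_ns_ring)
  define J where "J = (\<lambda>x. s1 + x) ` S \<union> (\<lambda>x. s2 + x) ` S"
  define I where "I = {f \<in> carrier ?R. \<forall>x. f x \<noteq> 0 \<longrightarrow> x \<in> J}"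
  have I_D: "f \<in> carrier ?R" "f x \<noteq> 0 \<Longrightarrow> x \<in> J" if "f \<in> I" for f x
    using that by (auto simp: I_def)
  have J_add: "a + b \<in> J" if "a \<in> S" "b \<in> J" for a b
    using that base.add_mem unfolding J_def by (force simp: add.left_commute)
  have mult_I: "r \<otimes>\<^bsub>?R\<^esub> f \<in> I" if "f \<in> I" "r \<in> carrier ?R" for f r
  proof -
    have "x \<in> J" if "(r \<otimes>\<^bsub>?R\<^esub> f) x \<noteq> 0" for x
    proof -
      have "base.conv r f x \<noteq> 0"
        using that \<open>f \<in> I\<close> \<open>r \<in> carrier ?R\<close> by (simp add: R.h_mult I_D)
      then obtain a b where "(a, b) \<in> base.splits x" "f b \<noteq> 0" by (rule base.conv_nonzeroE)
      then have "a \<in> S" "b \<in> J" "x = a + b" using I_D(2)[OF \<open>f \<in> I\<close>] by (auto simp: base.splits_def)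
      then show ?thesis using J_add by simp
    qed
    then show ?thesis using that by (simp add: I_def R.mult_closed)
  qed
  have I: "ideal I ?R"
  proof (rule idealI)
    show "subgroup I (add_monoid ?R)"
    proof (rule subgroup.intro)
      show "I \<subseteq> carrier (add_monoid ?R)" by (auto simp: I_def)
      show "\<one>\<^bsub>add_monoid ?R\<^esub> \<in> I" by (simp add: I_def R.h_zero base.carrier_ns_ring)
      fix f assume f: "f \<in> I"
      then have "\<ominus>\<^bsub>?R\<^esub> f \<in> I" using R.h_uminus[of f] R.a_inv_closed[of f] by (simp add: I_def)
      then show "inv\<^bsub>add_monoid ?R\<^esub> f \<in> I" by (simp only: a_inv_def)
      fix g assume g: "g \<in> I"
      have "x \<in> J" if "f x + g x \<noteq> 0" for x
        using that f g by (cases "f x = 0") (auto simp: I_def)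
      then show "f \<otimes>\<^bsub>add_monoid ?R\<^esub> g \<in> I"
        using f g R.h_add[of f g] R.add_closed[of f g] by (simp add: I_def)
    qed
  qed (use mult_I R.m_comm I_D R.ring_axioms in auto)
  let ?\<phi> = "\<lambda>(f, g). f s1 * g w1 :: 'k"
  have w': "w1 \<in> S'" "w2 \<in> S'" using w by (auto simp: apery_def)
  have u: "u_pow s1 \<in> I" "u_pow s2 \<in> I"
    using s base.zero_mem by (auto simp: I_def J_def base.carrier_ns_ring u_pow_def image_iff split: if_splits)
  have "?\<phi> (u_pow s1, u_pow w1) = ?\<phi> (u_pow s2, u_pow w2)"
  proof (rule flat_module_balanced[OF flat R.cring I, where \<phi> = ?\<phi>])
    show "u_pow s1 \<odot>\<^bsub>ring_as_module ?R'\<^esub> u_pow w1 = u_pow s2 \<odot>\<^bsub>ring_as_module ?R'\<^esub> u_pow w2"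
      by (simp add: ring_as_module_def u_pow_mult eq)
    fix r f g :: "rat \<Rightarrow> 'k"
    assume r: "r \<in> carrier ?R" and f: "f \<in> I" and g: "g \<in> carrier (ring_as_module ?R')"
    \<comment> \<open>Balancedness: both sides equal \<open>r 0 * f s1 * g w1\<close>. On the left,
      an exponent \<open>b\<close> in \<open>J\<close> with \<open>s1 = a + b\<close> either starts
      from \<open>s1\<close>, which forces \<open>a = 0\<close>, or from \<open>s2\<close>, which
      would put \<open>s1 - s2\<close> in \<open>S\<close>. On the right, \<open>w1\<close> is
      Apery.\<close>
    have "(r \<otimes>\<^bsub>?R\<^esub> f) s1 = base.conv r f s1" using r I_D(1)[OF f] by (rule fun_cong[OF R.h_mult])
    also have "\<dots> = r 0 * f s1"
    proof (rule base.conv_eq_if_left_trivial[OF s(1)])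
      fix a b assume ab: "(a, b) \<in> base.splits s1" "f b \<noteq> 0"
      then have "b \<in> J" "a \<in> S" "s1 = a + b" using I_D(2)[OF f] by (auto simp: base.splits_def)
      then consider c where "c \<in> S" "s1 = a + (s1 + c)" | c where "c \<in> S" "s1 = a + (s2 + c)"
        unfolding J_def by blast
      then show "a = 0"
      proof cases
        case 1
        then show ?thesis using base.nonneg[of a] base.nonneg[of c] \<open>a \<in> S\<close> by linarith
      next
        case 2
        then have "s1 - s2 = a + c" by simp
        then show ?thesis using False base.add_mem \<open>a \<in> S\<close> 2(1) by metis
      qed
    qed
    finally have 1: "(r \<otimes>\<^bsub>?R\<^esub> f) s1 = r 0 * f s1" .
    have "r \<odot>\<^bsub>ring_as_module ?R'\<^esub> g = ext.conv r g"
      unfolding ring_as_module_def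
      using r g subset by (auto intro!: ext.ns_ring_mult_eq_conv simp: base.carrier_ns_ring ext.carrier_ns_ring ring_as_module_def)
    moreover have "ext.conv r g w1 = r 0 * g w1"
    proof (rule ext.conv_eq_if_left_trivial[OF w'(1)])
      fix a b assume "(a, b) \<in> ext.splits w1" "r a \<noteq> 0"
      then have "a \<in> S" "b \<in> S'" "w1 = a + b" using r by (auto simp: ext.splits_def base.carrier_ns_ring)
      then show "a = 0" using w(1) unfolding apery_def by blast
    qed
    ultimately show "?\<phi> (r \<otimes>\<^bsub>?R\<^esub> f, g) = ?\<phi> (f, r \<odot>\<^bsub>ring_as_module ?R'\<^esub> g)"
      using 1 by simp
  qed (use u w' in \<open>auto simp: ring_as_module_def R.h_add I_D ext.carrier_ns_ring u_pow_def ns_ring_def[of S'] distrib_left distrib_right\<close>)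
  \<comment> \<open>The first value is 1, so the coefficient of the second series at
    \<open>s1\<close> cannot vanish.\<close>
  then show ?thesis by (simp add: u_pow_def split: if_splits)
qed

end

section \<open>Presentations by binomials\<close>

definition reduced :: "nat \<Rightarrow> (nat \<Rightarrow> nat) \<Rightarrow> nat multiset \<Rightarrow> bool" where
  "reduced n \<beta> A \<longleftrightarrow> (\<forall>i<n. count A i < \<beta> i)"

lemma sum_mset_sum_replicate:
  fixes f :: "nat \<Rightarrow> 'a::comm_semiring_1"
  shows "(\<Sum>i\<in>#(\<Sum>j<n. replicate_mset (l j) j). f i) = (\<Sum>j<n. of_nat (l j) * f j)"
  by (induction n) auto

lemma set_mset_sum_replicate: "set_mset (\<Sum>j<(n::nat). replicate_mset (l j) j) \<subseteq> {..<n}"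
  by (induction n) (auto simp: in_replicate_mset)

lemma count_sum_replicate: "i < (n::nat) \<Longrightarrow> count (\<Sum>j<n. replicate_mset (l j) j) i = l i"
  by (simp add: count_sum)

text \<open>The interface between the two halves of the proof. Flatness and the rectangle survive as
  \<open>reduced_exists\<close> and \<open>reduced_unique\<close>, invertibility of the matrix as
  \<open>potential\<close>.\<close>

locale binomial_presentation = semigroup_extension S' N S n s
  for S' S :: "rat set" and N n s +
  fixes \<beta> :: "nat \<Rightarrow> nat" and t :: "nat \<Rightarrow> rat" and B :: "nat \<Rightarrow> nat \<Rightarrow> nat" and v :: "nat \<Rightarrow> rat"
  assumes t_mem: "i < n \<Longrightarrow> t i \<in> S"
    and relation: "i < n \<Longrightarrow> of_nat (\<beta> i) * s i = t i + (\<Sum>j<n. of_nat (B i j) * s j)"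
    and potential: "i < n \<Longrightarrow> of_nat (\<beta> i) * v i - (\<Sum>j<n. of_nat (B i j) * v j) = 1"
    and reduced_exists: "d \<in> S' \<Longrightarrow> \<exists>x\<in>monomials. reduced n \<beta> (fst x) \<and> degree x = d"
    and reduced_unique: "x \<in> monomials \<Longrightarrow> y \<in> monomials \<Longrightarrow> reduced n \<beta> (fst x) \<Longrightarrow>
      reduced n \<beta> (fst y) \<Longrightarrow> degree x = degree y \<Longrightarrow> x = y"
begin

section \<open>The binomials and their homogeneous combinations\<close>

definition lhs :: "nat \<Rightarrow> nat multiset \<times> rat" where
  "lhs i = (replicate_mset (\<beta> i) i, 0)"

definition rhs :: "nat \<Rightarrow> nat multiset \<times> rat" where
  "rhs i = (\<Sum>j<n. replicate_mset (B i j) j, t i)"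

definition binomial :: "nat \<Rightarrow> nat multiset \<times> rat \<Rightarrow> 'k::field" where
  "binomial i = (\<lambda>x. (if x = lhs i then 1 else 0) - (if x = rhs i then 1 else 0))"

lemma lhs_mem: "i < n \<Longrightarrow> lhs i \<in> monomials"
  by (auto simp: lhs_def mem_monomials base.zero_mem in_replicate_mset)

lemma rhs_mem: "i < n \<Longrightarrow> rhs i \<in> monomials"
  using set_mset_sum_replicate[of "B i" n] by (simp add: rhs_def mem_monomials t_mem)

lemma degree_lhs_eq_rhs: "i < n \<Longrightarrow> degree (lhs i) = degree (rhs i)"
  using relation[of i] by (simp add: lhs_def rhs_def degree_def sum_mset_sum_replicate)

lemma binomial_mem: "i < n \<Longrightarrow> binomial i x \<noteq> 0 \<Longrightarrow> x \<in> monomials"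
  using lhs_mem rhs_mem by (auto simp: binomial_def split: if_splits)

lemma conv_single_binomial:
  assumes "z \<in> monomials" "i < n"
  shows "mon.conv (\<lambda>x. if x = z then 1 else 0) (binomial i) y
    = (if y = z + lhs i then 1 else 0) - (if y = z + rhs i then 1 else (0 :: 'k::field))"
proof -
  have "mon.conv (\<lambda>x. if x = z then 1 else 0) (binomial i) y
      = mon.conv (binomial i) (\<lambda>x. if x = z then 1 else (0 :: 'k)) y"
    by (subst mon.conv_commute) simp
  also have "\<dots> = (if y = lhs i + z then 1 else 0) - (if y = rhs i + z then 1 else (0 :: 'k))"
    unfolding binomial_def mon.conv_diff_left
    by (simp add: mon.conv_single lhs_mem rhs_mem assms)
  finally show ?thesis by (simp add: add.commute)
qed

text \<open>
  The coefficients \<open>G i\<close> are homogeneous so that infinitely many degrees can be assembled into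
  power series.
\<close>

definition combination :: "nat \<Rightarrow> (nat multiset \<times> rat \<Rightarrow> 'k::field) \<Rightarrow> bool" where
  "combination d f \<longleftrightarrow>
     (\<exists>G. (\<forall>i<n. \<forall>z. G i z \<noteq> 0 \<longrightarrow> z \<in> monomials \<and> weight (z + lhs i) = d) \<and>
          (\<forall>y. f y = (\<Sum>i<n. mon.conv (G i) (binomial i) y)))"

lemma combination_zero: "combination d (\<lambda>_. 0)"
  unfolding combination_def
  by (intro exI[of _ "\<lambda>_ _. 0"]) (simp add: mon.conv_zero_left)

lemma combination_add:
  assumes "combination d f" "combination d g"
  shows "combination d (\<lambda>y. f y + g y)"
proof -
  from assms obtain G H where
    G: "\<forall>i<n. \<forall>z. G i z \<noteq> 0 \<longrightarrow> z \<in> monomials \<and> weight (z + lhs i) = d"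
      "\<forall>y. f y = (\<Sum>i<n. mon.conv (G i) (binomial i) y)" and
    H: "\<forall>i<n. \<forall>z. H i z \<noteq> 0 \<longrightarrow> z \<in> monomials \<and> weight (z + lhs i) = d"
      "\<forall>y. g y = (\<Sum>i<n. mon.conv (H i) (binomial i) y)"
    unfolding combination_def by blast
  show ?thesis
    unfolding combination_def
  proof (intro exI[of _ "\<lambda>i z. G i z + H i z"] conjI allI impI)
    fix i z assume "i < n" "G i z + H i z \<noteq> 0"
    then have "G i z \<noteq> 0 \<or> H i z \<noteq> 0" by auto
    then show "z \<in> monomials" "weight (z + lhs i) = d" using G(1) H(1) \<open>i < n\<close> by blast+
  qed (simp add: G(2) H(2) mon.conv_add_left sum.distrib)
qed

lemma combination_scale:
  assumes "combination d f"
  shows "combination d (\<lambda>y. c * f y)"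
proof -
  from assms obtain G where
    G: "\<forall>i<n. \<forall>z. G i z \<noteq> 0 \<longrightarrow> z \<in> monomials \<and> weight (z + lhs i) = d"
      "\<forall>y. f y = (\<Sum>i<n. mon.conv (G i) (binomial i) y)"
    unfolding combination_def by blast
  show ?thesis
    unfolding combination_def
    by (intro exI[of _ "\<lambda>i z. c * G i z"])
      (use G in \<open>simp add: mon.conv_scale_left sum_distrib_left\<close>)
qed

lemma combination_sum:
  assumes "finite J" "\<And>j. j \<in> J \<Longrightarrow> combination d (f j)"
  shows "combination d (\<lambda>y. \<Sum>j\<in>J. f j y)"
  using assms by (induction J) (simp_all add: combination_zero combination_add)

lemma combination_step:
  assumes "z \<in> monomials" "i < n"
  shows "combination (weight (z + lhs i))
    (\<lambda>y. (if y = z + lhs i then 1 else 0) - (if y = z + rhs i then 1 else (0 :: 'k::field)))"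
proof -
  let ?G = "\<lambda>j x. if j = i \<and> x = z then 1 else (0 :: 'k)"
  have "(\<Sum>j<n. mon.conv (?G j) (binomial j) y)
      = (if y = z + lhs i then 1 else 0) - (if y = z + rhs i then 1 else 0)" for y
  proof -
    have "mon.conv (?G j) (binomial j) y
        = (if j = i then mon.conv (\<lambda>x. if x = z then 1 else 0) (binomial j) y else 0)" for j
      by (simp add: mon.conv_zero_left)
    then show ?thesis using assms by (simp add: conv_single_binomial)
  qed
  with assms show ?thesis
    unfolding combination_def by (intro exI[of _ ?G]) auto
qed

text \<open>Linear extension of \<open>v\<close>, with value 0 on the monomials of \<open>R\<close>.
  Entries of \<open>v\<close> may be negative, so \<open>pot\<close> has no evident lower bound and
  is not itself a termination measure.\<close>

definition pot :: "nat multiset \<times> rat \<Rightarrow> rat" where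
  "pot x = (\<Sum>i\<in>#fst x. v i)"

lemma pot_add: "pot (x + y) = pot x + pot y"
  by (simp add: pot_def)

lemma pot_lhs: "i < n \<Longrightarrow> pot (lhs i) = pot (rhs i) + 1"
  using potential[of i] by (simp add: pot_def lhs_def rhs_def sum_mset_sum_replicate)

text \<open>The measure counts the monomials of the same weight with smaller potential. A
  replacement keeps the weight and lowers the potential, so this finite set shrinks strictly. The
  combinations telescope: \<open>x - y = (x - x') + (x' - y)\<close>.\<close>

lemma reduces:
  assumes "x \<in> monomials"
  shows "\<exists>y\<in>monomials. reduced n \<beta> (fst y) \<and> degree y = degree x \<and>
    combination (weight x) (\<lambda>e. (if e = x then 1 else 0) - (if e = y then 1 else (0 :: 'k::field)))"
  using assms
proof (induction "card {y \<in> monomials. weight y = weight x \<and> pot y < pot x}"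
    arbitrary: x rule: less_induct)
  case less
  show ?case
  proof (cases "reduced n \<beta> (fst x)")
    case True
    then show ?thesis using less.prems combination_zero by (intro bexI[of _ x]) auto
  next
    case False
    then obtain i where i: "i < n" "\<beta> i \<le> count (fst x) i"
      by (auto simp: reduced_def not_less)
    then obtain C where C: "fst x = replicate_mset (\<beta> i) i + C"
      by (metis count_le_replicate_mset_subset_eq subset_mset.le_iff_add)
    define z where "z = (C, snd x)"
    have z: "z \<in> monomials" "x = z + lhs i"
      using less.prems C by (cases x; auto simp: z_def lhs_def mem_monomials)+
    define x' where "x' = z + rhs i"
    have x': "x' \<in> monomials" using z i by (simp add: x'_def mon.add_mem rhs_mem)
    have deg: "degree x' = degree x" using i by (simp add: z(2) x'_def degree_add degree_lhs_eq_rhs)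
    have pot: "pot x' < pot x" using i by (simp add: z(2) x'_def pot_add pot_lhs)
    let ?below = "\<lambda>x. {y \<in> monomials. weight y = weight x \<and> pot y < pot x}"
    have "?below x' \<subseteq> ?below x" using deg pot less_trans by fastforce
    moreover have "x' \<in> ?below x" "x' \<notin> ?below x'" using deg pot x' by simp_all
    ultimately have "?below x' \<subset> ?below x" by blast
    moreover have "finite (?below x)"
      by (rule finite_subset[OF _ mon.finite_fibre[of "weight x"]]) auto
    ultimately have "card (?below x') < card (?below x)" by (intro psubset_card_mono)
    then obtain y where y: "y \<in> monomials" "reduced n \<beta> (fst y)" "degree y = degree x'"
        "combination (weight x') (\<lambda>e. (if e = x' then 1 else 0) - (if e = y then 1 else (0 :: 'k)))"
      using less.hyps x' by blast
    have "combination (weight x) (\<lambda>e. (if e = x then 1 else 0) - (if e = x' then 1 else (0 :: 'k)))"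
      using combination_step[OF z(1) i(1)] by (simp add: z(2) x'_def)
    from combination_add[OF this y(4)[unfolded deg]]
    have "combination (weight x) (\<lambda>e. (if e = x then 1 else 0) - (if e = y then 1 else (0 :: 'k)))"
      by simp
    with y deg show ?thesis by auto
  qed
qed

text \<open>All monomials of weight \<open>d\<close> reduce to the same \<open>w\<close>. Hence the
  part of weight \<open>d\<close> is the sum of the \<open>f x * (x - w)\<close> plus the total of
  the coefficients times \<open>w\<close>, and that total vanishes.\<close>

lemma combination_if_sum_zero:
  assumes supp: "\<And>x. f x \<noteq> 0 \<Longrightarrow> x \<in> monomials"
    and zero: "(\<Sum>x | x \<in> monomials \<and> weight x = d. f x) = (0 :: 'k::field)"
  shows "combination d (\<lambda>e. if weight e = d then f e else 0)"
proof -
  let ?M = "{x \<in> monomials. weight x = d}"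
  have "\<forall>x\<in>monomials. \<exists>y. y \<in> monomials \<and> reduced n \<beta> (fst y) \<and> degree y = degree x \<and>
      combination (weight x) (\<lambda>e. (if e = x then 1 else 0) - (if e = y then 1 else (0 :: 'k)))"
    using reduces by blast
  from bchoice[OF this] obtain y where
    y: "\<And>x. x \<in> monomials \<Longrightarrow> y x \<in> monomials \<and> reduced n \<beta> (fst (y x)) \<and>
      degree (y x) = degree x \<and>
      combination (weight x) (\<lambda>e. (if e = x then 1 else 0) - (if e = y x then 1 else (0 :: 'k)))"
    by blast
  have "y x = y x'" if "x \<in> ?M" "x' \<in> ?M" for x x'
    using that y[of x] y[of x'] by (intro reduced_unique) (auto simp: weight_eq_iff)
  then have w: "y x = y (SOME x. x \<in> ?M)" if "x \<in> ?M" for x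
    using someI[of "\<lambda>x. x \<in> ?M", OF that] that by blast
  define w where "w = y (SOME x. x \<in> ?M)"
  have "combination d (\<lambda>e. \<Sum>x\<in>?M. f x * ((if e = x then 1 else 0) - (if e = w then 1 else 0)))"
  proof (intro combination_sum combination_scale mon.finite_fibre)
    fix x assume x: "x \<in> ?M"
    then show "combination d (\<lambda>e. (if e = x then 1 else 0) - (if e = w then 1 else (0 :: 'k)))"
      using y[of x] w[OF x] by (auto simp: w_def)
  qed
  moreover have "(\<Sum>x\<in>?M. f x * ((if e = x then 1 else 0) - (if e = w then 1 else 0)))
      = (if weight e = d then f e else 0)" for e
  proof -
    have "(\<Sum>x\<in>?M. f x * ((if e = x then 1 else 0) - (if e = w then 1 else 0)))
        = (\<Sum>x\<in>?M. if e = x then f x else 0) - (\<Sum>x\<in>?M. f x) * (if e = w then 1 else 0)"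
      unfolding sum_distrib_right sum_subtractf[symmetric] by (rule sum.cong) auto
    also have "\<dots> = (if weight e = d then f e else 0)"
      using supp[of e] by (auto simp: zero mon.finite_fibre)
    finally show ?thesis .
  qed
  ultimately show ?thesis by simp
qed

lemma conv_combination_if_sum_zero:
  assumes supp: "\<And>x. f x \<noteq> 0 \<Longrightarrow> x \<in> monomials"
    and zero: "\<And>d. (\<Sum>x | x \<in> monomials \<and> weight x = d. f x) = (0 :: 'k::field)"
  obtains G where "\<forall>i<n. \<forall>z. G i z \<noteq> 0 \<longrightarrow> z \<in> monomials"
    "f = (\<lambda>y. \<Sum>i<n. mon.conv (G i) (binomial i) y)"
proof -
  have "\<forall>d. \<exists>G. (\<forall>i<n. \<forall>z. G i z \<noteq> 0 \<longrightarrow> z \<in> monomials \<and> weight (z + lhs i) = d) \<and>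
      (\<forall>y. (if weight y = d then f y else 0) = (\<Sum>i<n. mon.conv (G i) (binomial i) y))"
    using combination_if_sum_zero[OF supp zero] unfolding combination_def by blast
  from choice[OF this] obtain G where
    all: "\<forall>d. (\<forall>i<n. \<forall>z. G d i z \<noteq> 0 \<longrightarrow> z \<in> monomials \<and> weight (z + lhs i) = d) \<and>
      (\<forall>y. (if weight y = d then f y else 0) = (\<Sum>i<n. mon.conv (G d i) (binomial i) y))" ..
  have G: "z \<in> monomials \<and> weight (z + lhs i) = d" if "i < n" "G d i z \<noteq> 0" for d i z
    using spec[OF all, of d] that by blast
  have f: "(if weight y = d then f y else 0) = (\<Sum>i<n. mon.conv (G d i) (binomial i) y)" for d y
    using spec[OF all, of d] by blast
  \<comment> \<open>At \<open>z\<close> the coefficient is taken from the only degree in which it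
    can be non-zero. Both terms of a binomial have equal degree, so at \<open>y\<close> just the
    coefficients belonging to \<open>weight y\<close> are seen.\<close>
  define H where "H = (\<lambda>i z. G (weight (z + lhs i)) i z)"
  have "mon.conv (H i) (binomial i) y = mon.conv (G (weight y) i) (binomial i) y" if "i < n" for i y
    unfolding mon.conv_def
  proof (rule sum.cong[OF refl], clarify)
    fix a b assume ab: "(a, b) \<in> mon.splits y"
    show "H i a * binomial i b = G (weight y) i a * (binomial i b :: 'k)"
    proof (cases "binomial i b = (0 :: 'k)")
      case False
      then have "b = lhs i \<or> b = rhs i" by (auto simp: binomial_def split: if_splits)
      then have "degree (a + lhs i) = degree (a + b)"
        using \<open>i < n\<close> degree_lhs_eq_rhs by (auto simp: degree_add)
      with ab show ?thesis by (auto simp: H_def mon.splits_def)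
    qed simp
  qed
  moreover have "f y = (\<Sum>i<n. mon.conv (G (weight y) i) (binomial i) y)" for y
    using f[of y "weight y"] by simp
  ultimately have "f = (\<lambda>y. \<Sum>i<n. mon.conv (H i) (binomial i) y)"
    by (intro ext) simp
  moreover have "\<forall>i<n. \<forall>z. H i z \<noteq> 0 \<longrightarrow> z \<in> monomials"
    using G unfolding H_def by blast
  ultimately show ?thesis by (rule that[rotated])
qed

section \<open>Substituting \<open>u\<close> to the power \<open>s i\<close> for \<open>Y i\<close>,
  on coefficients\<close>

definition push :: "(nat multiset \<times> rat \<Rightarrow> 'k::field) \<Rightarrow> rat \<Rightarrow> 'k" where
  "push f d = (\<Sum>x | x \<in> monomials \<and> degree x = d. f x)"

lemma finite_degree: "finite {x \<in> monomials. degree x = d}"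
  by (rule finite_subset[OF _ mon.finite_fibre[of "scaled N d"]]) auto

lemma push_mem: "push f d \<noteq> 0 \<Longrightarrow> d \<in> S'"
  unfolding push_def using degree_mem by (metis (mono_tags, lifting) mem_Collect_eq sum.neutral)

text \<open>Only the trivial monomial has degree 0. Preservation of constant terms is what makes the
  substitution a local homomorphism.\<close>

lemma push_at_0: "push f 0 = f 0"
proof -
  have "{x \<in> monomials. degree x = 0} = {0}"
    using mon.wt_eq_0D mon.zero_mem ext.wt_0 by (auto simp: degree_def)
  then show ?thesis by (simp add: push_def)
qed

lemma push_single:
  assumes "x \<in> monomials"
  shows "push (\<lambda>y. if y = x then c else 0) = (\<lambda>d. if d = degree x then c else 0)"
  using assms by (auto simp: push_def fun_eq_iff finite_degree)

lemma push_add: "push (\<lambda>x. f x + g x) d = push f d + push g d"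
  by (simp add: push_def sum.distrib)

lemma push_diff: "push (\<lambda>x. f x - g x) d = push f d - push g d"
  by (simp add: push_def sum_subtractf)

lemma push_conv: "push (mon.conv f g) = ext.conv (push f) (push g)"
proof
  fix d
  let ?M = "\<lambda>d. {x \<in> monomials. degree x = d}"
  have "push (mon.conv f g) d = (\<Sum>x\<in>?M d. \<Sum>p\<in>mon.splits x. f (fst p) * g (snd p))"
    by (simp add: push_def mon.conv_def case_prod_beta)
  also have "\<dots> = (\<Sum>(x, p)\<in>(SIGMA x:?M d. mon.splits x). f (fst p) * g (snd p))"
    by (rule sum.Sigma) (auto simp: finite_degree mon.finite_splits)
  \<comment> \<open>Pairs of monomials are regrouped by their two degrees instead of by their
    product; additivity of \<open>degree\<close> matches the index sets.\<close>
  also have "\<dots> = (\<Sum>(q, p)\<in>(SIGMA q:ext.splits d. ?M (fst q) \<times> ?M (snd q)). f (fst p) * g (snd p))"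
    by (rule sum.reindex_bij_witness
        [where j = "\<lambda>(x, p). ((degree (fst p), degree (snd p)), p)"
          and i = "\<lambda>(q, p). (fst p + snd p, p)"])
      (auto simp: mon.splits_def ext.splits_def degree_mem
        degree_add[of "(A, a)" "(C, c)" for A a C c, simplified]
        mon.add_mem[of "(A, a)" "(C, c)" for A a C c, simplified])
  also have "\<dots> = (\<Sum>q\<in>ext.splits d. \<Sum>p\<in>?M (fst q) \<times> ?M (snd q). f (fst p) * g (snd p))"
    by (rule sum.Sigma[symmetric]) (auto simp: finite_degree ext.finite_splits)
  also have "\<dots> = ext.conv (push f) (push g) d"
    by (simp add: ext.conv_def push_def case_prod_beta sum_product sum.cartesian_product)
  finally show "push (mon.conv f g) d = ext.conv (push f) (push g) d" .
qed

lemma sum_fibre_eq_0: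
  assumes "push f = (\<lambda>_. 0)"
  shows "(\<Sum>x | x \<in> monomials \<and> weight x = d. f x) = 0"
proof (cases "{x \<in> monomials. weight x = d} = {}")
  case True
  then show ?thesis by (simp only: sum.empty)
next
  case False
  then obtain y where y: "y \<in> monomials" "weight y = d" by blast
  have "{x \<in> monomials. weight x = d} = {x \<in> monomials. degree x = degree y}"
    unfolding y(2)[symmetric] using y(1) by (auto simp: weight_eq_iff)
  then show ?thesis using fun_cong[OF assms, of "degree y"] by (simp only: push_def)
qed

lemma push_surj:
  assumes "\<And>d. g d \<noteq> 0 \<Longrightarrow> d \<in> S'"
  obtains f where "\<And>x. f x \<noteq> 0 \<Longrightarrow> x \<in> monomials" "push f = g"
proof
  \<comment> \<open>A preimage carried by normal forms: the coefficient of \<open>g\<close> in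
    degree \<open>d\<close> sits on the unique reduced monomial of that degree.\<close>
  let ?f = "\<lambda>x. if x \<in> monomials \<and> reduced n \<beta> (fst x) then g (degree x) else 0"
  show "push ?f = g"
  proof
    fix d
    show "push ?f d = g d"
    proof (cases "d \<in> S'")
      case True
      then obtain y where y: "y \<in> monomials" "reduced n \<beta> (fst y)" "degree y = d"
        using reduced_exists by blast
      have "push ?f d = (\<Sum>x\<in>{x \<in> monomials. degree x = d}. if x = y then g d else 0)"
        unfolding push_def by (rule sum.cong) (use y reduced_unique in auto)
      then show ?thesis using y by (simp add: finite_degree)
    next
      case False
      then have "push ?f d = 0" "g d = 0" using push_mem[of ?f d] assms[of d] by blast+
      then show ?thesis by simp
    qed
  qed
qed (auto split: if_splits)

theorem complete_intersection_ns_ring: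
  "complete_intersection (ns_ring S :: (rat \<Rightarrow> 'k::field) ring) (ns_ring S')"
proof -
  let ?R = "ns_ring S :: (rat \<Rightarrow> 'k) ring" and ?R' = "ns_ring S' :: (rat \<Rightarrow> 'k) ring"
  let ?P = "power_series_ring ?R n"
  let ?h = "\<lambda>f (A, a). f A a"
  interpret R: convolution_ring S "scaled N" ?R "\<lambda>f. f" by (rule base.convolution_ring_ns_ring)
  interpret R': convolution_ring S' "scaled N" ?R' "\<lambda>f. f" by (rule ext.convolution_ring_ns_ring)
  interpret P: convolution_ring monomials weight ?P ?h by (rule convolution_ring_power_series_ring)
  define \<Phi> :: "(nat multiset \<Rightarrow> rat \<Rightarrow> 'k) \<Rightarrow> rat \<Rightarrow> 'k" where "\<Phi> = (\<lambda>f. push (?h f))"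
  have \<Phi>_carrier: "\<Phi> f \<in> carrier ?R'" for f
    unfolding \<Phi>_def ext.carrier_ns_ring using push_mem by blast
  have hom: "\<Phi> \<in> Ring.ring_hom ?P ?R'"
  proof (rule ring_hom_memI)
    fix f g assume fg: "f \<in> carrier ?P" "g \<in> carrier ?P"
    show "\<Phi> (f \<otimes>\<^bsub>?P\<^esub> g) = \<Phi> f \<otimes>\<^bsub>?R'\<^esub> \<Phi> g"
      using R'.h_mult[OF \<Phi>_carrier \<Phi>_carrier] P.h_mult[OF fg] by (simp add: \<Phi>_def push_conv)
    show "\<Phi> (f \<oplus>\<^bsub>?P\<^esub> g) = \<Phi> f \<oplus>\<^bsub>?R'\<^esub> \<Phi> g"
      unfolding R'.h_add[OF \<Phi>_carrier \<Phi>_carrier] unfolding \<Phi>_def P.h_add[OF fg] push_add ..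
  next
    show "\<Phi> \<one>\<^bsub>?P\<^esub> = \<one>\<^bsub>?R'\<^esub>"
      unfolding \<Phi>_def P.h_one R'.h_one push_single[OF mon.zero_mem] by (simp add: degree_def)
  qed (rule \<Phi>_carrier)
  interpret hom: ring_hom_ring ?P ?R' \<Phi>
    by (rule ring_hom_ringI2[OF P.ring_axioms R'.ring_axioms hom])
  have local_hom: "\<Phi> \<in> local_ring_hom ?P ?R'"
    using hom P.local_ring R'.local_ring \<Phi>_carrier
    by (auto simp: local_ring_hom_def P.maximalideal_iff R'.maximalideal_iff P.nonunits_def
        R'.nonunits_def \<Phi>_def push_at_0 zero_prod_def)
  have const: "\<Phi> (ring.indexed_const ?R r) = r" if r: "r \<in> carrier ?R" for r
  proof
    fix d
    have "\<Phi> (ring.indexed_const ?R r) d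
        = (\<Sum>x\<in>{x \<in> monomials. degree x = d}. if x = ({#}, d) then r d else 0)"
      unfolding \<Phi>_def push_def R.indexed_const_def
      by (rule sum.cong) (auto simp: degree_def R.h_zero split: if_splits)
    also have "\<dots> = r d"
    proof (cases "d \<in> S")
      case True
      then have "({#}, d) \<in> {x \<in> monomials. degree x = d}" by (simp add: mem_monomials degree_def)
      then show ?thesis by (simp add: finite_degree)
    next
      case False
      then have "r d = 0" using r by (auto simp: base.carrier_ns_ring)
      then show ?thesis by (auto intro!: sum.neutral)
    qed
    finally show "\<Phi> (ring.indexed_const ?R r) d = r d" .
  qed
  have surj: "\<Phi> ` carrier ?P = carrier ?R'"
  proof (intro equalityI subsetI)
    fix g assume "g \<in> carrier ?R'"
    then obtain f where f: "\<And>x. f x \<noteq> 0 \<Longrightarrow> x \<in> monomials" "push f = g"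
      using push_surj[of g] by (auto simp: ext.carrier_ns_ring)
    obtain F where "F \<in> carrier ?P" "?h F = f" by (rule P.h_surj[of f, OF f(1)])
    then show "g \<in> \<Phi> ` carrier ?P" using f(2) by (intro image_eqI[of _ _ F]) (simp_all add: \<Phi>_def)
  qed (use \<Phi>_carrier in blast)
  \<comment> \<open>Currying back: coefficient functions on \<open>monomials\<close> become elements
    of the power series ring.\<close>
  define lift where "lift = inv_into (carrier ?P) ?h"
  have lift: "lift f \<in> carrier ?P" "?h (lift f) = f" if "\<And>x. f x \<noteq> 0 \<Longrightarrow> x \<in> monomials" for f
  proof -
    have "f \<in> ?h ` carrier ?P" unfolding P.image_h using that by blast
    then show "lift f \<in> carrier ?P" "?h (lift f) = f"
      unfolding lift_def by (rule inv_into_into, rule f_inv_into_f)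
  qed
  define F where "F = (\<lambda>i. lift (binomial i))"
  have F: "F i \<in> carrier ?P" "?h (F i) = binomial i" if "i < n" for i
    unfolding F_def by (rule lift, erule binomial_mem[OF that])+
  have F_carrier: "F ` {..<n} \<subseteq> carrier ?P"
    by (rule image_subsetI) (simp add: F(1))
  have \<Phi>_F: "\<Phi> (F i) = \<zero>\<^bsub>?R'\<^esub>" if "i < n" for i
  proof -
    have "\<Phi> (F i) = push (binomial i)" using F(2)[OF that] by (simp add: \<Phi>_def)
    also have "\<dots> = (\<lambda>_. 0)"
      using degree_lhs_eq_rhs[OF that]
      by (simp add: binomial_def fun_eq_iff push_diff push_single lhs_mem rhs_mem that)
    finally show ?thesis by (simp add: R'.h_zero)
  qed
  have "a_kernel ?P ?R' \<Phi> = Idl\<^bsub>?P\<^esub> (F ` {..<n})"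
  proof (rule equalityI)
    show "Idl\<^bsub>?P\<^esub> (F ` {..<n}) \<subseteq> a_kernel ?P ?R' \<Phi>"
    proof (rule P.genideal_minimal[OF hom.kernel_is_ideal], rule image_subsetI)
      fix i assume "i \<in> {..<n}"
      then have "i < n" by simp
      then show "F i \<in> a_kernel ?P ?R' \<Phi>"
        unfolding a_kernel_def' using F(1) \<Phi>_F by blast
    qed
    show "a_kernel ?P ?R' \<Phi> \<subseteq> Idl\<^bsub>?P\<^esub> (F ` {..<n})"
    proof
      fix f assume "f \<in> a_kernel ?P ?R' \<Phi>"
      then have f: "f \<in> carrier ?P" "push (?h f) = (\<lambda>_. 0)"
        by (auto simp: a_kernel_def' \<Phi>_def R'.h_zero)
      obtain G where G: "\<forall>i<n. \<forall>z. G i z \<noteq> 0 \<longrightarrow> z \<in> monomials"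
          "?h f = (\<lambda>y. \<Sum>i<n. mon.conv (G i) (binomial i) y)"
        by (rule conv_combination_if_sum_zero[OF P.h_memD[OF f(1)] sum_fibre_eq_0[OF f(2)]])
      define g where "g = (\<lambda>i. lift (G i))"
      have g: "g i \<in> carrier ?P" "?h (g i) = G i" if "i < n" for i
        unfolding g_def by (rule lift, use G(1) that in blast)+
      interpret I: ideal "Idl\<^bsub>?P\<^esub> (F ` {..<n})" ?P
        by (rule P.genideal_ideal[OF F_carrier])
      \<comment> \<open>The partial sums over the binomials lie in the ideal, one multiple
        \<open>g k\<close> times \<open>F k\<close> being added at a time.\<close>
      have "\<exists>e. e \<in> Idl\<^bsub>?P\<^esub> (F ` {..<n}) \<and> ?h e = (\<lambda>y. \<Sum>i<k. mon.conv (G i) (binomial i) y)"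
        if "k \<le> n" for k
        using that
      proof (induction k)
        case 0
        show ?case
          by (rule exI[of _ "\<zero>\<^bsub>?P\<^esub>"]) (simp add: I.zero_closed P.h_zero)
      next
        case (Suc k)
        then obtain e where e: "e \<in> Idl\<^bsub>?P\<^esub> (F ` {..<n})"
            "?h e = (\<lambda>y. \<Sum>i<k. mon.conv (G i) (binomial i) y)" by auto
        have k: "k < n" using Suc.prems by simp
        have "F k \<in> Idl\<^bsub>?P\<^esub> (F ` {..<n})"
          using P.genideal_self[OF F_carrier] k by blast
        then have gF: "g k \<otimes>\<^bsub>?P\<^esub> F k \<in> Idl\<^bsub>?P\<^esub> (F ` {..<n})"
          using g(1)[OF k] I.I_l_closed by blast
        moreover have "?h (e \<oplus>\<^bsub>?P\<^esub> g k \<otimes>\<^bsub>?P\<^esub> F k) = (\<lambda>y. \<Sum>i<Suc k. mon.conv (G i) (binomial i) y)"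
          unfolding P.h_add[OF I.Icarr[OF e(1)] I.Icarr[OF gF]] P.h_mult[OF g(1)[OF k] F(1)[OF k]]
            e(2) g(2)[OF k] F(2)[OF k] by simp
        ultimately show ?case using e(1) I.a_closed by blast
      qed
      from this[of n] obtain e where "e \<in> Idl\<^bsub>?P\<^esub> (F ` {..<n})" "?h e = ?h f"
        using G(2) by auto
      then show "f \<in> Idl\<^bsub>?P\<^esub> (F ` {..<n})" using P.h_eqI[OF I.Icarr f(1)] by metis
    qed
  qed
  then show ?thesis
    unfolding complete_intersection_def using local_hom const surj F_carrier
    by (intro exI[of _ n] exI[of _ \<Phi>] conjI ballI exI[of _ F] funcsetI) (assumption | blast)+
qed

end

section \<open>Non-singular rectangles\<close>

text \<open>The solution is the inverse matrix applied to the all-ones vector. For the matrix of a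
  rectangle, row \<open>i\<close> says that the \<open>i\<close>-th replacement lowers the potential
  by one.\<close>

lemma invertible_mat_potential:
  fixes M :: "nat \<times> nat \<Rightarrow> rat"
  assumes "invertible_mat (mat n n M)"
  obtains v where "\<forall>i<n. (\<Sum>j<n. M (i, j) * v j) = 1"
proof -
  let ?A = "mat n n M" and ?e = "vec n (\<lambda>_. 1 :: rat)"
  obtain C where C: "?A * C = 1\<^sub>m n" "C * ?A = 1\<^sub>m (dim_row C)"
    using assms by (auto simp: invertible_mat_def inverts_mat_def)
  \<comment> \<open>The two inverse equations do not state the shape of \<open>C\<close>; comparing
    numbers of columns recovers it.\<close>
  have "dim_col C = n" using arg_cong[OF C(1), of dim_col] by simp
  moreover have "dim_row C = n" using arg_cong[OF C(2), of dim_col] by simp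
  ultimately have dim: "C \<in> carrier_mat n n" by auto
  define w where "w = C *\<^sub>v ?e"
  have w: "w \<in> carrier_vec n" unfolding w_def using dim by simp
  have "?A *\<^sub>v w = (?A * C) *\<^sub>v ?e"
    unfolding w_def using dim by (intro assoc_mult_mat_vec[symmetric]) auto
  then have Aw: "?A *\<^sub>v w = ?e" using C(1) by simp
  have "(\<Sum>j<n. M (i, j) * w $ j) = 1" if "i < n" for i
  proof -
    have "(?A *\<^sub>v w) $ i = (\<Sum>j<n. M (i, j) * w $ j)"
      using that w by (auto simp: scalar_prod_def atLeast0LessThan intro!: sum.cong)
    then show ?thesis using that Aw by simp
  qed
  then show ?thesis using that by blast
qed

section \<open>From Apery monomials and power products to exponents\<close>

context nested_semigroups
begin

lemma u_pow_carrier: "a \<in> S' \<Longrightarrow> u_pow a \<in> carrier (ns_ring S')"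
  by (auto simp: ext.carrier_ns_ring u_pow_def)

lemma u_pow_nat_pow:
  "u_pow a [^]\<^bsub>ns_ring S'\<^esub> k = (u_pow (of_nat k * a) :: rat \<Rightarrow> 'k::field)"
proof -
  interpret R': convolution_ring S' "scaled N" "ns_ring S' :: (rat \<Rightarrow> 'k) ring" "\<lambda>f. f"
    by (rule ext.convolution_ring_ns_ring)
  show ?thesis
    by (induction k) (simp_all add: u_pow_one[of S', symmetric] u_pow_mult algebra_simps)
qed

lemma power_product_eq:
  assumes "\<And>i. i < n \<Longrightarrow> s i \<in> S'"
  shows "power_product S' n s l = (u_pow (\<Sum>i<n. of_nat (l i) * s i) :: rat \<Rightarrow> 'k::field)"
proof -
  interpret R': convolution_ring S' "scaled N" "ns_ring S' :: (rat \<Rightarrow> 'k) ring" "\<lambda>f. f"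
    by (rule ext.convolution_ring_ns_ring)
  have mem: "u_pow (s i) [^]\<^bsub>ns_ring S'\<^esub> l i \<in> carrier (ns_ring S' :: (rat \<Rightarrow> 'k) ring)" if "i < n" for i
    by (rule R'.nat_pow_closed[OF u_pow_carrier[OF assms[OF that]]])
  have "(\<Otimes>\<^bsub>ns_ring S'\<^esub>i\<in>{..<k}. u_pow (s i) [^]\<^bsub>ns_ring S'\<^esub> l i)
      = (u_pow (\<Sum>i<k. of_nat (l i) * s i) :: rat \<Rightarrow> 'k)" if "k \<le> n" for k
    using that
  proof (induction k)
    case 0
    show ?case by (simp add: u_pow_one[of S', symmetric])
  next
    case (Suc k)
    then have "(\<Otimes>\<^bsub>ns_ring S'\<^esub>i\<in>insert k {..<k}. u_pow (s i) [^]\<^bsub>ns_ring S'\<^esub> l i)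
        = u_pow (s k) [^]\<^bsub>ns_ring S'\<^esub> l k
          \<otimes>\<^bsub>ns_ring S'\<^esub> (\<Otimes>\<^bsub>ns_ring S'\<^esub>i\<in>{..<k}. u_pow (s i) [^]\<^bsub>ns_ring S'\<^esub> l i :: rat \<Rightarrow> 'k)"
      using mem by (intro R'.finprod_insert) auto
    also have "\<dots> = u_pow (\<Sum>i<Suc k. of_nat (l i) * s i)"
      using Suc by (simp add: u_pow_nat_pow u_pow_mult add.commute)
    finally show ?case by (simp add: lessThan_Suc)
  qed
  then show ?thesis by (simp add: power_product_def)
qed

lemma apery_monomials_eq: "(apery_monomials S S' :: (rat \<Rightarrow> 'k::field) set) = u_pow ` apery"
  by (auto simp: apery_monomials_def apery_def u_pow_mult u_pow_inject u_pow_one[symmetric])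

text \<open>An exponent that is not Apery splits off a non-zero element of \<open>S\<close>; the
  rest has smaller weight, so the process ends.\<close>

lemma apery_decomposition:
  assumes "d \<in> S'"
  shows "\<exists>a\<in>S. \<exists>w\<in>apery. d = a + w"
  using assms
proof (induction "scaled N d" arbitrary: d rule: less_induct)
  case less
  show ?case
  proof (cases "d \<in> apery")
    case True
    then show ?thesis using base.zero_mem by (intro bexI[of _ 0] bexI[of _ d]) auto
  next
    case False
    then obtain a b where ab: "a \<in> S" "b \<in> S'" "d = a + b" "a \<noteq> 0"
      using less.prems unfolding apery_def by blast
    then have "scaled N a \<noteq> 0" "scaled N d = scaled N a + scaled N b"
      using base.wt_eq_0D[of a] ext.wt_add[of a b] subset by auto
    then obtain a' w where "a' \<in> S" "w \<in> apery" "b = a' + w"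
      using less.hyps[of b] ab(2) by auto
    then show ?thesis
      using ab base.add_mem by (intro bexI[of _ "a + a'"] bexI[of _ w]) (auto simp: add.assoc)
  qed
qed

section \<open>Normal forms and relations given by a rectangle\<close>

context
  fixes n :: nat and s :: "nat \<Rightarrow> rat" and \<beta> :: "nat \<Rightarrow> nat"
  assumes rectangle: "apery_rectangle TYPE('k::field) S S' n s \<beta>"
begin

lemma rectangle_generators:
  assumes "i < n"
  shows "s i \<in> S'" "s i \<noteq> 0"
proof -
  have "bij_betw (\<lambda>i. u_pow (s i)) {..<n} (minimal_monomials S S' :: (rat \<Rightarrow> 'k) set)"
    using rectangle by (simp add: apery_rectangle_def)
  then have "u_pow (s i) \<in> (minimal_monomials S S' :: (rat \<Rightarrow> 'k) set)"
    using assms by (auto dest: bij_betwE)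
  then have "(u_pow (s i) :: rat \<Rightarrow> 'k) \<in> u_pow ` apery" "(u_pow (s i) :: rat \<Rightarrow> 'k) \<noteq> u_pow 0"
    unfolding minimal_monomials_def apery_monomials_eq u_pow_one[of S'] by auto
  then show "s i \<in> S'" "s i \<noteq> 0" by (auto simp: u_pow_inject apery_def)
qed

lemma rectangle_mem_apery:
  assumes "l \<in> (\<Pi>\<^sub>E i\<in>{..<n}. {..<\<beta> i})"
  shows "(\<Sum>i<n. of_nat (l i) * s i) \<in> apery"
proof -
  have "(power_product S' n s l :: rat \<Rightarrow> 'k) \<in> u_pow ` apery"
    using rectangle assms unfolding apery_rectangle_def apery_monomials_eq by blast
  then show ?thesis by (auto simp: power_product_eq rectangle_generators u_pow_inject)
qed

lemma rectangle_ex1: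
  assumes "w \<in> apery"
  shows "\<exists>!l. l \<in> (\<Pi>\<^sub>E i\<in>{..<n}. {..<\<beta> i}) \<and> w = (\<Sum>i<n. of_nat (l i) * s i)"
proof -
  have "(u_pow w :: rat \<Rightarrow> 'k) \<in> apery_monomials S S'" using assms by (simp add: apery_monomials_eq)
  then have "\<exists>!l. l \<in> (\<Pi>\<^sub>E i\<in>{..<n}. {..<\<beta> i}) \<and> (u_pow w :: rat \<Rightarrow> 'k) = power_product S' n s l"
    using rectangle unfolding apery_rectangle_def by blast
  then show ?thesis by (simp add: power_product_eq rectangle_generators u_pow_inject)
qed

lemma rectangle_inj:
  assumes "l \<in> (\<Pi>\<^sub>E i\<in>{..<n}. {..<\<beta> i})" "l' \<in> (\<Pi>\<^sub>E i\<in>{..<n}. {..<\<beta> i})"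
    and "(\<Sum>i<n. of_nat (l i) * s i) = (\<Sum>i<n. of_nat (l' i) * s i)"
  shows "l = l'"
  using rectangle_ex1[OF rectangle_mem_apery[OF assms(1)]] assms by blast

text \<open>If \<open>B i\<close> were positive, cancelling \<open>B i\<close> copies of
  \<open>s i\<close> would leave \<open>\<beta> i - B i\<close> copies, an Apery exponent, equal to
  \<open>t\<close> plus an element of \<open>S'\<close>. Then \<open>t = 0\<close>, and
  \<open>?l\<close> and \<open>?l'\<close> are two points of the rectangle with the same sum that
  differ at \<open>i\<close>.\<close>

lemma rectangle_relation_diagonal:
  assumes i: "i < n" and t: "t \<in> S" and B: "\<And>j. j < n \<Longrightarrow> B j < \<beta> j"
    and eq: "of_nat (\<beta> i) * s i = t + (\<Sum>j<n. of_nat (B j) * s j)"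
  shows "B i = 0"
proof (rule ccontr)
  assume "B i \<noteq> 0"
  let ?l = "\<lambda>j\<in>{..<n}. if j = i then \<beta> i - B i else 0"
  let ?l' = "\<lambda>j\<in>{..<n}. if j = i then 0 else B j"
  have \<beta>: "0 < \<beta> j" if "j < n" for j using B[OF that] by simp
  have l: "?l \<in> (\<Pi>\<^sub>E i\<in>{..<n}. {..<\<beta> i})" "?l' \<in> (\<Pi>\<^sub>E i\<in>{..<n}. {..<\<beta> i})"
    using \<open>B i \<noteq> 0\<close> \<beta> B by auto
  have "(\<Sum>j<n. of_nat (?l j) * s j) = (\<Sum>j<n. if j = i then (of_nat (\<beta> i) - of_nat (B i)) * s i else 0)"
    by (rule sum.cong) (use B[OF i] in \<open>auto simp: of_nat_diff\<close>)
  then have suml: "(\<Sum>j<n. of_nat (?l j) * s j) = (of_nat (\<beta> i) - of_nat (B i)) * s i"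
    using i by simp
  have "(\<Sum>j<n. of_nat (?l' j) * s j)
      = (\<Sum>j<n. of_nat (B j) * s j - (if j = i then of_nat (B i) * s i else 0))"
    by (rule sum.cong) auto
  then have suml': "(\<Sum>j<n. of_nat (?l' j) * s j) = (\<Sum>j<n. of_nat (B j) * s j) - of_nat (B i) * s i"
    using i by (simp add: sum_subtractf)
  have split: "(\<Sum>j<n. of_nat (?l j) * s j) = t + (\<Sum>j<n. of_nat (?l' j) * s j)"
    unfolding suml suml' using eq by (simp add: left_diff_distrib)
  moreover have "(\<Sum>j<n. of_nat (?l j) * s j) \<in> apery" "(\<Sum>j<n. of_nat (?l' j) * s j) \<in> S'"
    using rectangle_mem_apery[OF l(1)] rectangle_mem_apery[OF l(2)] by (simp_all add: apery_def)
  ultimately have "t = 0" using t unfolding apery_def by blast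
  then have "?l = ?l'" using split by (intro rectangle_inj[OF l]) simp
  then have "?l i = ?l' i" by metis
  then show False using i B[OF i] by simp
qed

lemma semigroup_extension_rectangle: "semigroup_extension S' N S n s"
  by unfold_locales (use base.submonoid subset rectangle_generators in auto)

lemma complete_intersection_rectangle:
  assumes flat: "flat_module (ns_ring S :: (rat \<Rightarrow> 'k) ring) (ring_as_module (ns_ring S'))"
    and t: "\<And>i. i < n \<Longrightarrow> t i \<in> S" and B: "\<And>i j. i < n \<Longrightarrow> j < n \<Longrightarrow> B i j < \<beta> j"
    and eq: "\<And>i. i < n \<Longrightarrow> of_nat (\<beta> i) * s i = t i + (\<Sum>j<n. of_nat (B i j) * s j)"
    and inv: "invertible_mat
      (mat n n (\<lambda>(i, j). if i = j then of_nat (\<beta> i) else - of_nat (B i j)) :: rat mat)"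
  shows "complete_intersection (ns_ring S :: (rat \<Rightarrow> 'k) ring) (ns_ring S')"
proof -
  interpret semigroup_extension S' N S n s by (rule semigroup_extension_rectangle)
  obtain v :: "nat \<Rightarrow> rat" where v: "\<forall>i<n.
      (\<Sum>j<n. (case (i, j) of (i, j) \<Rightarrow> if i = j then of_nat (\<beta> i) else - of_nat (B i j)) * v j) = 1"
    by (rule invertible_mat_potential[OF inv])
  have "binomial_presentation S' S N n s \<beta> t B v"
  proof
    fix i assume i: "i < n"
    \<comment> \<open>The matrix has \<open>\<beta> i\<close> on its diagonal while the potential
      condition subtracts the full sum over \<open>j\<close>; the two agree because of this.\<close>
    have "B i i = 0" by (rule rectangle_relation_diagonal[OF i t[OF i] B[OF i] eq[OF i]])
    then have "(\<Sum>j<n. (if i = j then of_nat (\<beta> i) else - of_nat (B i j)) * v j)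
        = (\<Sum>j<n. (if j = i then of_nat (\<beta> i) * v i else 0) - of_nat (B i j) * v j)"
      by (intro sum.cong) auto
    then show "of_nat (\<beta> i) * v i - (\<Sum>j<n. of_nat (B i j) * v j) = 1"
      using v i by (simp add: sum_subtractf)
  next
    fix d assume "d \<in> S'"
    then obtain a w where aw: "a \<in> S" "w \<in> apery" "d = a + w" using apery_decomposition by blast
    then obtain l where l: "l \<in> (\<Pi>\<^sub>E i\<in>{..<n}. {..<\<beta> i})" "w = (\<Sum>i<n. of_nat (l i) * s i)"
      using rectangle_ex1 by blast
    \<comment> \<open>The Apery part of \<open>d\<close> supplies the exponents of the variables,
      the part in \<open>S\<close> the coefficient monomial.\<close>
    let ?x = "(\<Sum>j<n. replicate_mset (l j) j, a)"
    have "?x \<in> monomials" using aw set_mset_sum_replicate[of l n] by (simp add: mem_monomials)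
    moreover have "reduced n \<beta> (fst ?x)" using l(1) by (auto simp: reduced_def count_sum_replicate)
    moreover have "degree ?x = d" using aw l by (simp add: degree_def sum_mset_sum_replicate)
    ultimately show "\<exists>x\<in>monomials. reduced n \<beta> (fst x) \<and> degree x = d" by blast
  next
    fix x y
    assume mem: "x \<in> monomials" "y \<in> monomials"
      and red: "reduced n \<beta> (fst x)" "reduced n \<beta> (fst y)" and deg: "degree x = degree y"
    have box: "restrict (count (fst z)) {..<n} \<in> (\<Pi>\<^sub>E i\<in>{..<n}. {..<\<beta> i})" if "reduced n \<beta> (fst z)" for z :: "nat multiset \<times> rat"
      using that by (auto simp: reduced_def)
    have sum: "(\<Sum>i\<in>#fst z. s i) = (\<Sum>i<n. of_nat (restrict (count (fst z)) {..<n} i) * s i)"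
      if "z \<in> monomials" for z
      using that by (simp add: sum_mset_image_eq_sum_count[of _ n] monomials_def mem_Times_iff)
    have ap: "(\<Sum>i\<in>#fst z. s i) \<in> apery" if "z \<in> monomials" "reduced n \<beta> (fst z)" for z
      unfolding sum[OF that(1)] by (rule rectangle_mem_apery[OF box[OF that(2)]])
    \<comment> \<open>The variable parts of reduced monomials have Apery exponents, so flatness
      equates the parts in \<open>S\<close>; uniqueness in the rectangle then equates the
      multiplicities.\<close>
    have snd: "snd x = snd y"
      by (rule flat_imp_unique_decomposition[OF flat _ _ ap[OF mem(1) red(1)] ap[OF mem(2) red(2)]])
        (use mem deg in \<open>auto simp: monomials_def degree_def add.commute\<close>)
    then have "(\<Sum>i\<in>#fst x. s i) = (\<Sum>i\<in>#fst y. s i)" using deg by (simp add: degree_def)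
    then have l: "restrict (count (fst x)) {..<n} = restrict (count (fst y)) {..<n}"
      unfolding sum[OF mem(1)] sum[OF mem(2)] by (rule rectangle_inj[OF box[OF red(1)] box[OF red(2)]])
    have "count (fst x) i = count (fst y) i" for i
    proof (cases "i < n")
      case True
      then show ?thesis using fun_cong[OF l, of i] by simp
    next
      case False
      then have "i \<notin># fst x" "i \<notin># fst y" using mem by (auto simp: monomials_def)
      then show ?thesis by (simp add: not_in_iff)
    qed
    then show "x = y" using snd by (simp add: prod_eq_iff multiset_eq_iff)
  qed (use t eq in auto)
  then show ?thesis by (rule binomial_presentation.complete_intersection_ns_ring)
qed

end

end

theorem theorem4p9:
  fixes S S' :: "rat set"
    and R R' :: "(rat \<Rightarrow> 'k::field) ring"
    and n :: nat and s :: "nat \<Rightarrow> rat" and \<beta> :: "nat \<Rightarrow> nat"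
  assumes "numerical_semigroup S" and "numerical_semigroup S'" and "S \<subseteq> S'"
    and "R = ns_ring S" and "R' = ns_ring S'"
    and "flat_module R (ring_as_module R')"
    and "nonsingular_apery_rectangle TYPE('k) S S' n s \<beta>"
  shows "complete_intersection R R'"
proof -
  \<comment> \<open>A denominator for the larger semigroup also serves the smaller one, so both get
    compatible weights.\<close>
  obtain N where N: "0 < N" "\<forall>x\<in>S'. \<exists>k::nat. x = of_nat k / of_nat N"
    by (rule numerical_semigroup_denominator[OF assms(2)])
  interpret nested_semigroups S' S N
    by unfold_locales
      (use N assms(3) add_submonoid_numerical_semigroup[OF assms(1)]
        add_submonoid_numerical_semigroup[OF assms(2)] in blast)+
  have rectangle: "apery_rectangle TYPE('k) S S' n s \<beta>"
    using assms(7) by (simp add: nonsingular_apery_rectangle_def)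
  obtain t B where tB: "\<And>i. i < n \<Longrightarrow> t i \<in> S" "\<And>i j. i < n \<Longrightarrow> j < n \<Longrightarrow> B i j < \<beta> j"
    and pow: "\<And>i. i < n \<Longrightarrow> (u_pow (s i * of_nat (\<beta> i)) :: rat \<Rightarrow> 'k)
      = u_pow (t i) \<otimes>\<^bsub>ns_ring S'\<^esub> power_product S' n s (B i)"
    and inv: "invertible_mat
      (mat n n (\<lambda>(i, j). if i = j then of_nat (\<beta> i) else - of_nat (B i j)) :: rat mat)"
    using assms(7) unfolding nonsingular_apery_rectangle_def by blast
  \<comment> \<open>Comparing exponents turns the factorization of monomials into a linear relation
    between rationals.\<close>
  have "of_nat (\<beta> i) * s i = t i + (\<Sum>j<n. of_nat (B i j) * s j)" if "i < n" for i
    using pow[OF that]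
    by (simp add: power_product_eq rectangle_generators[OF rectangle] u_pow_mult u_pow_inject mult.commute)
  then show ?thesis
    unfolding assms(4,5) using assms(6)[unfolded assms(4,5)]
    by (intro complete_intersection_rectangle[OF rectangle _ tB _ inv])
qed

end
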